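(* Let $k=\mathbb{C}$ and let $C\subset\mathbb{P}^2$ be an irreducible (possibly singular) plane curve over $k$ of degree $d$ $(d\geq 3)$. Suppose that $P\in\mathbb{P}^2$ is a Galois point for $C$ and that its Galois group $G_P$ is isomorphic to $\mathbb{Z}_3$, the cyclic group of order three. Then any element of $G_P$ has an expression as a de Jonquières transformation; that is, for every $\sigma\in G_P$, the birational transformation $\sigma: C\dashrightarrow C$ induced by $\sigma$ is the restriction to $C$ of a de Jonquières transformation of $\mathbb{P}^2$. In particular, any element of $G_P$ can be extended to a Cremona transformation of $\mathbb{P}^2$.
   Context: The ground field is $k=\mathbb{C}$. Let $C\subset\mathbb{P}^2$ be an irreducible (possibly singular) curve of degree $d\ge 3$ with function field $k(C)$. Galois point: For a point $P\in\mathbb{P}^2$ (either on $C$ or not on $C$), let $\pi_P: C\dashrightarrow\mathbb{P}^1$ be the restriction to $C$ of the projection $\mathbb{P}^2\dashrightarrow\mathbb{P}^1$ with center $P$. It induces a field extension $\pi_P^*: k(\mathbb{P}^1)\hookrightarrow k(C)$ of degree $d-m_P$, where $m_P$ is the multiplicity of $C$ at $P$ ($m_P=0$ if $P\notin C$). Put $K_P=\pi_P^*(k(\mathbb{P}^1))$. The point $P$ is called a Galois point for $C$ if $k(C)/K_P$ is a Galois extension; then $G_P=\mathrm{Gal}(k(C)/K_P)$ is called the Galois group at $P$. Each $\sigma\in G_P$ induces a birational transformation of $C$ over $\mathbb{P}^1$, denoted by the same letter $\sigma$. Cremona transformation: a birational transformation of $\mathbb{P}^2$, i.e. an element of $\mathrm{Bir}(\mathbb{P}^2)$.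 A birational transformation $\sigma$ of $C$ extends to (is the restriction of) a Cremona transformation $\Phi$ if $\Phi$ is defined at the generic point of $C$ and $\Phi|_C=\sigma$ as rational maps. De Jonquières transformation: a Cremona transformation $\Phi$ for which there exists a point $o\in\mathbb{P}^2$ such that the restriction of $\Phi$ to a general line passing through $o$ maps it birationally to a line passing through $o$. Equivalently, in coordinates $(x_0:x_1:x_2)$ with $o=(0:0:1)$, $\Phi$ is a Cremona transformation of the form $(q g_0: q g_1: f)$, where $(g_0:g_1)$ defines a birational map of the line $\{x_2=0\}\cong\mathbb{P}^1$ and $q,f\in k[x_0,x_1,x_2]$ are relatively prime $x_2$-monoids (forms of degree at most $1$ in $x_2$), at least one of which has positive $x_2$-degree. Projective linear transformations with this property (including the identity) are counted as de Jonquières transformations. *)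

theory Defs
  imports
    "HOL-Algebra.Bij"
    "HOL-Algebra.QuotRing"
    "HOL-Algebra.Embedded_Algebras"
    "HOL-Algebra.Elementary_Groups"
    "HOL-Analysis.Cartesian_Space"
    "HOL-Computational_Algebra.Polynomial"
    "HOL-Computational_Algebra.Fraction_Field"
begin

section \<open>Forms in three variables and rational maps\<close>

text \<open>
  The polynomial ring \<open>k[x0, x1, x2]\<close> over the complex numbers is represented as
  \<open>k[x0][x1][x2]\<close>: the outermost polynomial variable is \<open>x2\<close>, so that \<open>degree\<close> is the
  \<open>x2\<close>-degree, and the innermost one is \<open>x0\<close>. In vectors of length three the indices
  1, 2, 3 belong to \<open>x0, x1, x2\<close>.
\<close>

type_synonym mpoly = "complex poly poly poly"

definition const :: "complex \<Rightarrow> mpoly" where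
  "const c = [:[:[:c:]:]:]"

definition X :: "mpoly ^ 3" where
  "X = vector [[:[:[:0, 1:]:]:], [:[:0, 1:]:], [:0, 1:]]"

definition is_form :: "nat \<Rightarrow> mpoly \<Rightarrow> bool" where
  "is_form n G \<longleftrightarrow>
     (\<forall>i j k. Polynomial.coeff (Polynomial.coeff (Polynomial.coeff G k) j) i \<noteq> 0 \<longrightarrow> i + j + k = n)"

text \<open>Forms in \<open>x0, x1\<close> only.\<close>

definition binary_form :: "nat \<Rightarrow> mpoly \<Rightarrow> bool" where
  "binary_form n G \<longleftrightarrow> is_form n G \<and> Polynomial.degree G = 0"

definition eval_with :: "('a::zero \<Rightarrow> 'b::comm_semiring_1) \<Rightarrow> 'b \<Rightarrow> 'a poly \<Rightarrow> 'b" where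
  "eval_with h t p = poly (map_poly h p) t"

text \<open>The substitution \<open>G(\<Phi>0, \<Phi>1, \<Phi>2)\<close>.\<close>

definition subst :: "mpoly ^ 3 \<Rightarrow> mpoly \<Rightarrow> mpoly" where
  "subst \<Phi> G = eval_with (eval_with (eval_with const (\<Phi> $ 1)) (\<Phi> $ 2)) (\<Phi> $ 3) G"

text \<open>
  A rational map from the projective plane to itself is given by a nonzero triple of forms of
  the same degree; common factors are allowed, and proportional triples give the same map.
\<close>

definition rational_map :: "mpoly ^ 3 \<Rightarrow> bool" where
  "rational_map \<Phi> \<longleftrightarrow> \<Phi> \<noteq> 0 \<and> (\<exists>n. \<forall>i. is_form n (\<Phi> $ i))"

definition same_map :: "mpoly ^ 3 \<Rightarrow> mpoly ^ 3 \<Rightarrow> bool" where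
  "same_map \<Phi> \<Psi> \<longleftrightarrow> \<Phi> \<noteq> 0 \<and> \<Psi> \<noteq> 0 \<and> (\<forall>i j. \<Phi> $ i * \<Psi> $ j = \<Phi> $ j * \<Psi> $ i)"

text \<open>First \<open>\<Phi>\<close>, then \<open>\<Psi>\<close>; the result is zero if \<open>\<Psi>\<close> is undefined along the image of \<open>\<Phi>\<close>.\<close>

definition map_comp :: "mpoly ^ 3 \<Rightarrow> mpoly ^ 3 \<Rightarrow> mpoly ^ 3" where
  "map_comp \<Psi> \<Phi> = (\<chi> i. subst \<Phi> (\<Psi> $ i))"

definition cremona :: "mpoly ^ 3 \<Rightarrow> bool" where
  "cremona \<Phi> \<longleftrightarrow> rational_map \<Phi> \<and>
     (\<exists>\<Psi>. rational_map \<Psi> \<and> same_map (map_comp \<Psi> \<Phi>) X \<and> same_map (map_comp \<Phi> \<Psi>) X)"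


section \<open>De Jonquieres transformations\<close>

definition linear_form :: "complex ^ 3 \<Rightarrow> mpoly" where
  "linear_form u = (\<Sum>i\<in>UNIV. const (u $ i) * X $ i)"

definition linear_map :: "complex ^ 3 ^ 3 \<Rightarrow> mpoly ^ 3" where
  "linear_map A = (\<chi> i. linear_form (A $ i))"

text \<open>
  \<open>(g0 : g1)\<close> defines a birational map of the line \<open>x2 = 0\<close> with coordinates \<open>x0, x1\<close>.
\<close>

definition birational_on_line :: "nat \<Rightarrow> mpoly \<Rightarrow> mpoly \<Rightarrow> bool" where
  "birational_on_line n g0 g1 \<longleftrightarrow> binary_form n g0 \<and> binary_form n g1 \<and>
     (\<exists>m h0 h1. binary_form m h0 \<and> binary_form m h1 \<and>
        same_map (map_comp (vector [h0, h1, 0]) (vector [g0, g1, 0])) (vector [X $ 1, X $ 2, 0]) \<and>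
        same_map (map_comp (vector [g0, g1, 0]) (vector [h0, h1, 0])) (vector [X $ 1, X $ 2, 0]))"

text \<open>The form \<open>(q g0 : q g1 : f)\<close> of a de Jonquieres map with respect to \<open>o = (0 : 0 : 1)\<close>.\<close>

definition de_jonquieres_form :: "mpoly ^ 3 \<Rightarrow> bool" where
  "de_jonquieres_form \<Psi> \<longleftrightarrow>
     (\<exists>m n q g0 g1 f. \<Psi> = vector [q * g0, q * g1, f] \<and>
        birational_on_line n g0 g1 \<and>
        is_form m q \<and> is_form (m + n) f \<and>
        Polynomial.degree q \<le> 1 \<and> Polynomial.degree f \<le> 1 \<and>
        (Polynomial.degree q = 1 \<or> Polynomial.degree f = 1) \<and>
        coprime q f)"

text \<open>
  The centre \<open>o\<close> is arbitrary: \<open>A\<close> is the change to coordinates in which \<open>o = (0 : 0 : 1)\<close>,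
  used on source and target, so \<open>\<Psi> = A \<Phi> A\<inverse>\<close>.
\<close>

definition de_jonquieres :: "mpoly ^ 3 \<Rightarrow> bool" where
  "de_jonquieres \<Phi> \<longleftrightarrow> cremona \<Phi> \<and>
     (\<exists>A \<Psi>. invertible A \<and> de_jonquieres_form \<Psi> \<and>
        same_map (map_comp (linear_map A) \<Phi>) (map_comp \<Psi> (linear_map A)))"


section \<open>Plane curves and their function fields\<close>

text \<open>An irreducible plane curve is given by its irreducible defining form.\<close>

definition irreducible_plane_curve :: "nat \<Rightarrow> mpoly \<Rightarrow> bool" where
  "irreducible_plane_curve d F \<longleftrightarrow> is_form d F \<and> irreducible F"

text \<open>
  The function field of the curve \<open>F = 0\<close> is the residue field of the local ring of the plane
  at the generic point of the curve.
\<close>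

definition local_ring :: "mpoly \<Rightarrow> mpoly fract ring" where
  "local_ring F =
     \<lparr>carrier = {Fract G H | G H n. is_form n G \<and> is_form n H \<and> \<not> F dvd H},
      monoid.mult = (*), one = 1, zero = 0, add = (+)\<rparr>"

definition vanishing_ideal :: "mpoly \<Rightarrow> mpoly fract set" where
  "vanishing_ideal F =
     {Fract G H | G H n. is_form n G \<and> is_form n H \<and> \<not> F dvd H \<and> F dvd G}"

definition function_field :: "mpoly \<Rightarrow> mpoly fract set ring" where
  "function_field F = local_ring F Quot vanishing_ideal F"

text \<open>The restriction of the rational function \<open>G/H\<close> to the curve.\<close>

definition rat_fun :: "mpoly \<Rightarrow> mpoly \<Rightarrow> mpoly \<Rightarrow> mpoly fract set" where
  "rat_fun F G H = vanishing_ideal F +>\<^bsub>local_ring F\<^esub> Fract G H"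


section \<open>Galois points\<close>

text \<open>Elements of the Galois group are extensional, so that they form a set of maps on \<open>L\<close>.\<close>

definition gal_group :: "('a, 'b) ring_scheme \<Rightarrow> 'a set \<Rightarrow> ('a \<Rightarrow> 'a) monoid" where
  "gal_group L K = BijGroup (carrier L)
     \<lparr>carrier := {\<sigma> \<in> ring_hom L L \<inter> Bij (carrier L). \<forall>x\<in>K. \<sigma> x = x}\<rparr>"

text \<open>Finite, and the fixed field of the automorphism group over \<open>K\<close> is \<open>K\<close> itself.\<close>

definition galois_extension :: "('a, 'b) ring_scheme \<Rightarrow> 'a set \<Rightarrow> bool" where
  "galois_extension L K \<longleftrightarrow> Ring.field L \<and> subfield K L \<and>
     ring.finite_dimension L K (carrier L) \<and>
     {x \<in> carrier L. \<forall>\<sigma> \<in> carrier (gal_group L K). \<sigma> x = x} = K"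

text \<open>
  The projection with centre \<open>P\<close> is \<open>(l : m)\<close> for linearly independent linear forms \<open>l, m\<close>
  vanishing at \<open>P\<close>; they are given by their coefficient vectors.
\<close>

definition projection_from :: "complex ^ 3 \<Rightarrow> complex ^ 3 \<Rightarrow> complex ^ 3 \<Rightarrow> bool" where
  "projection_from P l m \<longleftrightarrow>
     (\<Sum>i\<in>UNIV. l $ i * P $ i) = 0 \<and> (\<Sum>i\<in>UNIV. m $ i * P $ i) = 0 \<and>
     (\<forall>a b. a *s l + b *s m = 0 \<longrightarrow> a = 0 \<and> b = 0)"

text \<open>
  The field \<open>K\<^sub>P\<close> of pull-backs \<open>A(l, m) / B(l, m)\<close> of the rational functions \<open>A / B\<close> on the
  projective line. It does not depend on the choice of \<open>l, m\<close>.
\<close>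

definition pullback_field :: "mpoly \<Rightarrow> complex ^ 3 \<Rightarrow> mpoly fract set set" where
  "pullback_field F P =
     {rat_fun F (subst (vector [linear_form l, linear_form m, 0]) A)
                (subst (vector [linear_form l, linear_form m, 0]) B) | l m A B n.
        projection_from P l m \<and> binary_form n A \<and> binary_form n B \<and>
        \<not> F dvd subst (vector [linear_form l, linear_form m, 0]) B}"

definition galois_point :: "mpoly \<Rightarrow> complex ^ 3 \<Rightarrow> bool" where
  "galois_point F P \<longleftrightarrow> P \<noteq> 0 \<and> galois_extension (function_field F) (pullback_field F P)"

definition galois_group_at ::
    "mpoly \<Rightarrow> complex ^ 3 \<Rightarrow> (mpoly fract set \<Rightarrow> mpoly fract set) monoid" where
  "galois_group_at F P = gal_group (function_field F) (pullback_field F P)"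


section \<open>Extension of birational transformations of a curve\<close>

text \<open>
  The triple \<open>s\<close> does not vanish identically on the curve \<open>F = 0\<close>, maps it dominantly to itself,
  and the induced map \<open>G/H \<mapsto> G(s)/H(s)\<close> on the function field is \<open>\<sigma>\<close>. For an
  automorphism \<open>\<sigma>\<close> this says that \<open>s\<close> defines the birational transformation of the curve
  induced by \<open>\<sigma>\<close>.
\<close>

definition induces :: "mpoly \<Rightarrow> mpoly ^ 3 \<Rightarrow> (mpoly fract set \<Rightarrow> mpoly fract set) \<Rightarrow> bool" where
  "induces F s \<sigma> \<longleftrightarrow> rational_map s \<and> (\<exists>i. \<not> F dvd s $ i) \<and> F dvd subst s F \<and>
     (\<forall>n G H. is_form n G \<and> is_form n H \<and> \<not> F dvd H \<longrightarrow>
        \<not> F dvd subst s H \<and> \<sigma> (rat_fun F G H) = rat_fun F (subst s G) (subst s H))"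

text \<open>
  The representing triple may have to be replaced by a proportional one (with common factors
  divided out) in order not to vanish identically on the curve.
\<close>

definition restricts_to ::
    "mpoly \<Rightarrow> mpoly ^ 3 \<Rightarrow> (mpoly fract set \<Rightarrow> mpoly fract set) \<Rightarrow> bool" where
  "restricts_to F \<Phi> \<sigma> \<longleftrightarrow> (\<exists>\<Phi>'. same_map \<Phi> \<Phi>' \<and> induces F \<Phi>' \<sigma>)"

end

theory Submission
  imports
    Defs
    "HOL-Analysis.Determinants"
    "HOL-Computational_Algebra.Field_as_Ring"
    "HOL-Computational_Algebra.Polynomial_Factorial"
begin

text \<open>
  Let \<open>y\<close> be an affine coordinate on the lines through \<open>P\<close>, so that the function field of the
  curve is \<open>K(y)\<close> with \<open>K = K\<^sub>P\<close>. For an automorphism \<open>\<sigma>\<close> of order three the Moebius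
  transformation that permutes \<open>y, \<sigma> y, \<sigma>\<^sup>2 y\<close> cyclically is unique, hence its coefficients can be
  chosen \<open>\<sigma>\<close>-invariant, that is, in \<open>K\<close>. So \<open>\<sigma> y = (a y + b) / (c y + e)\<close> with \<open>a, b, c, e\<close>
  rational functions on the pencil of lines through \<open>P\<close>. Clearing denominators and dividing out
  common factors turns this formula into a de Jonquieres map with centre \<open>P\<close>.
\<close>

section \<open>Forms and substitution\<close>

text \<open>A Moebius transformation is determined by the images of three distinct points. Applying
  \<open>\<sigma>\<close> to the coefficients only shifts the three conditions \<open>y \<mapsto>
  \<sigma> y \<mapsto> \<sigma>\<^sup>2 y \<mapsto> y\<close> cyclically, so the transformation
  stays the same. Invariance under the single \<open>\<sigma>\<close> gives membership in
  \<open>K\<^sub>P\<close> because a nontrivial element generates a group of order three and the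
  extension is Galois. If \<open>\<sigma>\<close> fixes \<open>y\<close>, the three points coincide
  and the identity map takes over. The obstacle is to turn a formula valid on the curve into one on
  the plane. Elements of the function field are cosets, so all calculations use fractions of forms
  modulo the ideal of fractions vanishing on the curve. After clearing denominators, the forms may
  share factors, and the new denominator might vanish on the curve. Dividing by the gcd settles both
  points: the gcd divides a product of forms that do not vanish on the curve, and coprimality keeps
  the remaining denominator from vanishing there. Coprimality is also what
  \<open>de_jonquieres_form\<close> requires.\<close>

definition monom3 :: "complex \<Rightarrow> nat \<Rightarrow> nat \<Rightarrow> nat \<Rightarrow> mpoly" where
  "monom3 c i j k = monom (monom (monom c i) j) k"

lemma monom_sum: "monom (sum f A) n = (\<Sum>x\<in>A. monom (f x) n)"
  by (induction A rule: infinite_finite_induct) (auto simp flip: add_monom)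

lemma mpoly_eq_sum_monom3:
  "G = (\<Sum>k\<le>Polynomial.degree G. \<Sum>j\<le>Polynomial.degree (Polynomial.coeff G k).
      \<Sum>i\<le>Polynomial.degree (Polynomial.coeff (Polynomial.coeff G k) j).
      monom3 (Polynomial.coeff (Polynomial.coeff (Polynomial.coeff G k) j) i) i j k)"
  by (simp add: monom3_def monom_sum[symmetric] poly_as_sum_of_monoms)

text \<open>A form is the sum of its coefficient monomials. The \<open>zero\<close> case is separate
  because the index ranges of that sum also contain monomials with coefficient 0 whose exponents
  need not add up to \<open>n\<close>.\<close>

lemma form_induct [consumes 1, case_names zero monom3 add]:
  assumes "is_form n G" and zero: "Q 0"
    and monom3: "\<And>c i j k. i + j + k = n \<Longrightarrow> Q (monom3 c i j k)"
    and add: "\<And>G H. Q G \<Longrightarrow> Q H \<Longrightarrow> Q (G + H)"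
  shows "Q G"
proof -
  let ?c = "\<lambda>i j k. Polynomial.coeff (Polynomial.coeff (Polynomial.coeff G k) j) i"
  have sum: "Q (sum f A)" if "\<And>x. x \<in> A \<Longrightarrow> Q (f x)" for f :: "nat \<Rightarrow> mpoly" and A
    using that by (induction A rule: infinite_finite_induct) (auto intro: zero add)
  have "Q (monom3 (?c i j k) i j k)" for i j k
  proof (cases "?c i j k = 0")
    case True
    then show ?thesis by (simp add: monom3_def zero)
  next
    case False
    then show ?thesis using assms(1) by (intro monom3) (auto simp: is_form_def)
  qed
  then show ?thesis by (subst mpoly_eq_sum_monom3) (intro sum)
qed

lemma mpoly_induct [case_names monom3 add]:
  assumes monom3: "\<And>c i j k. Q (monom3 c i j k)"
    and add: "\<And>G H. Q G \<Longrightarrow> Q H \<Longrightarrow> Q (G + H)"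
  shows "Q G"
proof -
  have zero: "Q 0" using monom3[of 0 0 0 0] by (simp add: monom3_def)
  have sum: "Q (sum f A)" if "\<And>x. x \<in> A \<Longrightarrow> Q (f x)" for f :: "nat \<Rightarrow> mpoly" and A
    using that by (induction A rule: infinite_finite_induct) (auto intro: zero add)
  show ?thesis by (subst mpoly_eq_sum_monom3) (intro sum monom3)
qed

lemma coeff_monom3:
  "Polynomial.coeff (Polynomial.coeff (Polynomial.coeff (monom3 c i j k) k') j') i' =
     (if i = i' \<and> j = j' \<and> k = k' then c else 0)"
  by (simp add: monom3_def)

lemma is_form_monom3: "i + j + k = n \<Longrightarrow> is_form n (monom3 c i j k)"
  by (simp add: is_form_def coeff_monom3)

lemma is_form_0 [simp]: "is_form n 0"
  by (simp add: is_form_def)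

lemma is_form_add [intro]: "is_form n G \<Longrightarrow> is_form n H \<Longrightarrow> is_form n (G + H)"
  unfolding is_form_def by (metis add.right_neutral coeff_add)

lemma is_form_uminus [intro]: "is_form n G \<Longrightarrow> is_form n (- G)"
  unfolding is_form_def by simp

lemma is_form_diff [intro]: "is_form n G \<Longrightarrow> is_form n H \<Longrightarrow> is_form n (G - H)"
  using is_form_add[of n G "- H"] is_form_uminus[of n H] by simp

lemma is_form_sum [intro]: "(\<And>x. x \<in> A \<Longrightarrow> is_form n (f x)) \<Longrightarrow> is_form n (sum f A)"
  by (induction A rule: infinite_finite_induct) auto

lemma monom3_mult: "monom3 c i j k * monom3 c' i' j' k' = monom3 (c * c') (i + i') (j + j') (k + k')"
  by (simp add: monom3_def mult_monom)

lemma is_form_mult [intro]: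
  assumes "is_form m G" "is_form n H"
  shows "is_form (m + n) (G * H)"
  using assms(1)
proof (induction rule: form_induct)
  case (monom3 c i j k)
  from assms(2) show ?case
    by (induction rule: form_induct)
       (use monom3 in \<open>auto simp: monom3_mult distrib_left intro!: is_form_monom3\<close>)
qed (auto simp: distrib_right)

lemma const_monom3: "const c = monom3 c 0 0 0"
  by (simp add: const_def monom3_def monom_0)

lemma X_monom3: "X $ 1 = monom3 1 1 0 0" "X $ 2 = monom3 1 0 1 0" "X $ 3 = monom3 1 0 0 1"
  by (simp_all add: X_def monom3_def monom_altdef one_pCons)

lemma monom3_eq: "monom3 c i j k = const c * X $ 1 ^ i * X $ 2 ^ j * X $ 3 ^ k"
proof -
  have "X $ 1 ^ i = monom3 1 i 0 0" "X $ 2 ^ j = monom3 1 0 j 0" "X $ 3 ^ k = monom3 1 0 0 k" for i j k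
    by (simp_all add: X_monom3 monom3_def monom_power)
  then show ?thesis by (simp add: const_monom3 monom3_mult)
qed

lemma is_form_const [simp]: "is_form 0 (const c)"
  by (simp add: const_monom3 is_form_monom3)

lemma is_form_1 [simp]: "is_form 0 1"
  using is_form_const[of 1] by (simp add: const_def one_pCons)

lemma is_form_X [simp]: "is_form 1 (X $ i)"
  using exhaust_3[of i] by (auto simp: X_monom3 intro!: is_form_monom3)

lemma is_form_X' [simp]: "is_form (Suc 0) (X $ i)"
  using is_form_X by simp

lemma is_form_power [intro]: "is_form m G \<Longrightarrow> is_form (m * k) (G ^ k)"
  by (induction k) (auto intro: is_form_mult)

lemma is_form_linear_form [simp]: "is_form 1 (linear_form u)"
  unfolding linear_form_def using is_form_mult[OF is_form_const is_form_X] by auto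

lemma is_form_linear_form' [simp]: "is_form (Suc 0) (linear_form u)"
  using is_form_linear_form by simp

section \<open>Ring homomorphisms out of the polynomial ring, and substitution\<close>

locale mpoly_hom =
  fixes h :: "mpoly \<Rightarrow> 'a::comm_ring_1"
  assumes add: "h (G + H) = h G + h H" and mult: "h (G * H) = h G * h H"
    and one: "h 1 = 1"
begin

lemma zero: "h 0 = 0"
  using add[of 0 0] by simp

lemma uminus: "h (- G) = - h G"
  using add[of G "- G"] by (simp add: zero eq_neg_iff_add_eq_0 add.commute)

lemma diff: "h (G - H) = h G - h H"
  using add[of G "- H"] by (simp add: uminus)

lemma power: "h (G ^ n) = h G ^ n"
  by (induction n) (simp_all add: one mult)

lemma sum: "h (sum f A) = (\<Sum>x\<in>A. h (f x))"
  by (induction A rule: infinite_finite_induct) (simp_all add: zero add)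

lemma monom3: "h (monom3 c i j k) = h (const c) * h (X $ 1) ^ i * h (X $ 2) ^ j * h (X $ 3) ^ k"
  by (simp add: monom3_eq mult power)

end

lemma mpoly_hom_eqI:
  assumes "mpoly_hom h" "mpoly_hom h'" "\<And>c. h (const c) = h' (const c)" "\<And>i. h (X $ i) = h' (X $ i)"
  shows "h G = h' G"
proof -
  interpret h: mpoly_hom h by fact
  interpret h': mpoly_hom h' by fact
  show ?thesis
    by (induction G rule: mpoly_induct) (simp_all add: h.monom3 h'.monom3 h.add h'.add assms)
qed

lemma eval_with_add:
  assumes "h 0 = 0" "\<And>x y. h (x + y) = h x + h y"
  shows "eval_with h t (p + q) = eval_with h t p + eval_with h t q"
proof -
  have "map_poly h (p + q) = map_poly h p + map_poly h q"
    by (rule poly_eqI) (simp add: coeff_map_poly assms)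
  then show ?thesis by (simp add: eval_with_def)
qed

lemma eval_with_monom:
  assumes "h 0 = 0"
  shows "eval_with h t (monom c n) = h c * t ^ n"
  by (simp add: eval_with_def map_poly_monom assms poly_monom)

lemma eval_with_0 [simp]: "eval_with h t 0 = 0"
  by (simp add: eval_with_def)

text \<open>The target ring is left open so that one construction gives both \<open>subst\<close>
  and the grading homomorphism \<open>homogenize\<close>, whose values are polynomials over
  \<open>mpoly\<close>.\<close>

definition eval3 :: "(complex \<Rightarrow> 'a::comm_ring_1) \<Rightarrow> 'a ^ 3 \<Rightarrow> mpoly \<Rightarrow> 'a" where
  "eval3 h v G = eval_with (eval_with (eval_with h (v $ 1)) (v $ 2)) (v $ 3) G"

lemma subst_eval3: "subst \<Phi> = eval3 const \<Phi>"
  by (simp add: subst_def eval3_def fun_eq_iff)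

context
  fixes h :: "complex \<Rightarrow> 'a::comm_ring_1"
  assumes h: "h 0 = 0" "h 1 = 1" "\<And>x y. h (x + y) = h x + h y" "\<And>x y. h (x * y) = h x * h y"
begin

lemma eval3_monom3: "eval3 h v (monom3 c i j k) = h c * v $ 1 ^ i * v $ 2 ^ j * v $ 3 ^ k"
  by (simp add: eval3_def monom3_def eval_with_monom h)

lemma eval3_add: "eval3 h v (G + H) = eval3 h v G + eval3 h v H"
  unfolding eval3_def by (intro eval_with_add) (auto simp: eval_with_add h)

lemma mpoly_hom_eval3: "mpoly_hom (eval3 h v)"
proof
  show "eval3 h v (G * H) = eval3 h v G * eval3 h v H" for G H
  proof (induction G rule: mpoly_induct)
    case (monom3 c i j k)
    show ?case
      by (induction H rule: mpoly_induct)
         (simp_all add: monom3_mult eval3_monom3 distrib_left distrib_right eval3_add h power_add mult_ac)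
  qed (simp add: distrib_right eval3_add)
  show "eval3 h v 1 = 1"
    using eval3_monom3[of v 1 0 0 0] by (simp add: monom3_def monom_0 one_pCons h)
qed (rule eval3_add)

lemma eval3_const: "eval3 h v (const c) = h c"
  by (simp add: const_monom3 eval3_monom3)

lemma eval3_X: "eval3 h v (X $ i) = v $ i"
  using exhaust_3[of i] by (auto simp: X_monom3 eval3_monom3 h)

end

lemma const_hom [simp]: "const 0 = 0" "const 1 = 1" "const (x + y) = const x + const y"
  "const (x * y) = const x * const y" "const (- x) = - const x" "const (x - y) = const x - const y"
  by (simp_all add: const_def one_pCons)

lemma const_eq_0_iff [simp]: "const c = 0 \<longleftrightarrow> c = 0"
  by (simp add: const_def)

interpretation subst: mpoly_hom "subst \<Phi>" for \<Phi>
  unfolding subst_eval3 by (intro mpoly_hom_eval3) auto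

lemma subst_const [simp]: "subst \<Phi> (const c) = const c"
  by (simp add: subst_eval3 eval3_const)

lemma subst_X [simp]: "subst \<Phi> (X $ i) = \<Phi> $ i"
  by (simp add: subst_eval3 eval3_X)

lemmas subst_simps = subst.zero subst.one subst.add subst.mult subst.diff subst.uminus subst.power
  subst.sum

lemma subst_monom3: "subst \<Phi> (monom3 c i j k) = const c * \<Phi> $ 1 ^ i * \<Phi> $ 2 ^ j * \<Phi> $ 3 ^ k"
  by (simp add: subst.monom3)

lemma subst_id [simp]: "subst X G = G"
  by (rule mpoly_hom_eqI[where h = "subst X" and h' = "\<lambda>G. G"]) (unfold_locales, auto)

lemma subst_subst: "subst \<Phi> (subst \<Psi> G) = subst (map_comp \<Psi> \<Phi>) G"
  by (rule mpoly_hom_eqI[where h = "\<lambda>G. subst \<Phi> (subst \<Psi> G)"])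
     (unfold_locales, auto simp: subst_simps map_comp_def)

lemma map_comp_assoc: "map_comp (map_comp A B) C = map_comp A (map_comp B C)"
  by (simp add: vec_eq_iff map_comp_def subst_subst)

lemma is_form_subst:
  assumes "is_form n G" "\<And>i. is_form m (\<Phi> $ i)"
  shows "is_form (m * n) (subst \<Phi> G)"
  using assms(1)
proof (induction rule: form_induct)
  case (monom3 c i j k)
  have "is_form (0 + m * i + m * j + m * k) (const c * \<Phi> $ 1 ^ i * \<Phi> $ 2 ^ j * \<Phi> $ 3 ^ k)"
    by (intro is_form_mult is_form_power is_form_const assms)
  then show ?case using monom3 by (auto simp: subst_monom3 algebra_simps)
qed (auto simp: subst_simps)

lemma subst_scale:
  assumes "is_form n G"
  shows "subst (\<chi> i. s * \<Phi> $ i) G = s ^ n * subst \<Phi> G"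
  using assms
  by (induction rule: form_induct)
     (auto simp: subst_simps subst_monom3 power_mult_distrib power_add algebra_simps)

text \<open>
  The homomorphism \<open>x\<^sub>i \<mapsto> x\<^sub>i T\<close> turns forms of degree \<open>n\<close> into multiples of \<open>T\<^sup>n\<close>, so that
  statements about homogeneous factors become statements about monomials in \<open>T\<close>.
\<close>

definition homogenize :: "mpoly \<Rightarrow> mpoly poly" where
  "homogenize = eval3 (\<lambda>c. [:const c:]) (\<chi> i. monom (X $ i) 1)"

interpretation homogenize: mpoly_hom homogenize
  unfolding homogenize_def by (intro mpoly_hom_eval3) (auto simp: one_pCons)

lemma homogenize_monom3: "homogenize (monom3 c i j k) = monom (monom3 c i j k) (i + j + k)"
proof -
  have "homogenize (monom3 c i j k) =
      monom (const c) 0 * monom (X $ 1) 1 ^ i * monom (X $ 2) 1 ^ j * monom (X $ 3) 1 ^ k"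
    unfolding homogenize_def by (subst eval3_monom3) (auto simp: monom_0 one_pCons)
  then show ?thesis by (simp only: monom_power mult_monom) (simp add: monom3_eq)
qed

lemma coeff_homogenize:
  "Polynomial.coeff (Polynomial.coeff (Polynomial.coeff (Polynomial.coeff (homogenize G) n) k) j) i =
     (if i + j + k = n then Polynomial.coeff (Polynomial.coeff (Polynomial.coeff G k) j) i else 0)"
  by (induction G rule: mpoly_induct)
     (auto simp: homogenize_monom3 homogenize.add coeff_monom3)

lemma is_form_iff_homogenize: "is_form n G \<longleftrightarrow> homogenize G = monom G n"
proof
  assume "is_form n G"
  then show "homogenize G = monom G n"
    by (induction rule: form_induct)
       (auto simp: homogenize_monom3 homogenize.add homogenize.zero add_monom)
next
  assume *: "homogenize G = monom G n"
  show "is_form n G"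
    unfolding is_form_def
  proof (intro allI impI)
    fix i j k assume "Polynomial.coeff (Polynomial.coeff (Polynomial.coeff G k) j) i \<noteq> 0"
    with coeff_homogenize[of G n k j i] show "i + j + k = n"
      by (auto simp: * split: if_splits)
  qed
qed

lemma poly_homogenize: "poly (homogenize G) 1 = G"
  by (induction G rule: mpoly_induct)
     (auto simp: homogenize_monom3 homogenize.add poly_monom)

text \<open>Order of vanishing at 0 and degree are both additive, and the order is at most the
  degree. For the product they agree, so they agree for each factor, and a polynomial whose order
  equals its degree is a monomial.\<close>

lemma monom_factor:
  fixes p q :: "'a::idom poly"
  assumes "p * q = monom c n" "c \<noteq> 0"
  shows "\<exists>a m. p = monom a m \<and> m \<le> n"
proof -
  have pq: "p \<noteq> 0" "q \<noteq> 0" using assms by auto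
  have deg: "Polynomial.degree p + Polynomial.degree q = n"
    using pq assms by (metis degree_monom_eq degree_mult_eq)
  have "n \<le> order 0 (p * q)"
    using assms by (subst monom_1_dvd_iff[symmetric]) (auto intro!: dvdI[of _ _ "[:c:]"] simp: smult_monom)
  then have "n \<le> order 0 p + order 0 q"
    using pq by (simp add: order_mult)
  with deg order_degree[OF pq(1), of 0] order_degree[OF pq(2), of 0]
  have "Polynomial.degree p \<le> order 0 p" by linarith
  then obtain r where r: "p = monom 1 (Polynomial.degree p) * r"
    using monom_1_dvd_iff[OF pq(1)] by (auto elim: dvdE)
  then have "Polynomial.degree p = Polynomial.degree p + Polynomial.degree r"
    by (metis degree_monom_eq degree_mult_eq mult_zero_right one_neq_zero pq(1) mult_zero_left)
  then obtain a where "r = [:a:]" by (metis add_cancel_right_right degree_eq_zeroE)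
  with r have "p = monom a (Polynomial.degree p)" by (simp add: smult_monom)
  with deg show ?thesis by (metis le_add1)
qed

text \<open>\<open>homogenize\<close> turns the product into a monomial in the extra variable; its
  factors are monomials, and evaluation at 1 identifies their coefficients as \<open>G\<close> and
  \<open>H\<close>.\<close>

lemma form_factor:
  assumes "is_form n (G * H)" "G * H \<noteq> 0"
  obtains m where "m \<le> n" "is_form m G" "is_form (n - m) H"
proof -
  have *: "homogenize G * homogenize H = monom (G * H) n"
    using assms(1) by (simp add: is_form_iff_homogenize homogenize.mult)
  from monom_factor[OF this assms(2)] obtain a m where m: "homogenize G = monom a m" "m \<le> n"
    by auto
  have "a = G" using m(1) poly_homogenize[of G] by (simp add: poly_monom)
  from monom_factor[of "homogenize H" "homogenize G"] * assms(2)
  obtain b k where k: "homogenize H = monom b k" by (metis mult.commute)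
  have "b = H" using k poly_homogenize[of H] by (simp add: poly_monom)
  have "monom (G * H) (m + k) = monom (G * H) n"
    using * by (simp add: m k \<open>a = G\<close> \<open>b = H\<close> mult_monom)
  then have "m + k = n"
    using assms(2) by (metis degree_monom_eq)
  with m k \<open>a = G\<close> \<open>b = H\<close> that[of m] show ?thesis
    by (auto simp: is_form_iff_homogenize)
qed

lemma form_degree_unique: "is_form m G \<Longrightarrow> is_form n G \<Longrightarrow> G \<noteq> 0 \<Longrightarrow> m = n"
  by (metis is_form_iff_homogenize degree_monom_eq)

lemma form_dvd_degree_le:
  assumes "is_form d F" "is_form n G" "F dvd G" "G \<noteq> 0"
  shows "d \<le> n"
proof -
  from assms(3) obtain H where "G = F * H" by (elim dvdE)
  with assms form_factor[of n F H] form_degree_unique[of d F] show ?thesis by (metis mult_zero_left)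
qed

section \<open>De Jonquieres maps\<close>

lemma degree_0_subst_cong:
  assumes "Polynomial.degree G = 0" "\<Phi> $ 1 = \<Psi> $ 1" "\<Phi> $ 2 = \<Psi> $ 2"
  shows "subst \<Phi> G = subst \<Psi> G"
proof -
  from assms(1) obtain g where "G = [:g:]" by (elim degree_eq_zeroE)
  with assms(2,3) show ?thesis by (simp add: subst_def eval_with_def map_poly_pCons)
qed

lemma degree_mult_0:
  fixes G H :: "'a::comm_semiring_0 poly"
  shows "Polynomial.degree G = 0 \<Longrightarrow> Polynomial.degree H = 0 \<Longrightarrow> Polynomial.degree (G * H) = 0"
  by (metis add_0 degree_mult_le le_0_eq)

lemma degree_X [simp]: "Polynomial.degree (X $ 1) = 0" "Polynomial.degree (X $ 2) = 0"
  by (simp_all add: X_def)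

lemma degree_const [simp]: "Polynomial.degree (const c) = 0"
  by (simp add: const_def)

lemma binary_form_const [simp]: "binary_form 0 (const c)"
  and binary_form_X: "binary_form 1 (X $ 1)" "binary_form 1 (X $ 2)"
  by (simp_all add: binary_form_def)

lemma binary_form_mult: "binary_form m G \<Longrightarrow> binary_form n H \<Longrightarrow> binary_form (m + n) (G * H)"
  by (auto simp: binary_form_def degree_mult_0)

lemma degree_subst_0:
  assumes "\<And>i. Polynomial.degree (\<Phi> $ i) = 0"
  shows "Polynomial.degree (subst \<Phi> G) = 0"
proof (induction G rule: mpoly_induct)
  case (monom3 c i j k)
  have "Polynomial.degree (p ^ n) = 0" if "Polynomial.degree p = 0" for p :: mpoly and n
    using that by (induction n) (simp_all add: degree_mult_0)
  then show ?case by (simp add: subst_monom3 degree_mult_0 assms)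
next
  case (add G H)
  then show ?case using degree_add_le_max[of "subst \<Phi> G" "subst \<Phi> H"] by (simp add: subst_simps)
qed

section \<open>Linear coordinate changes and proportional triples\<close>

lemma subst_linear_form: "subst \<Phi> (linear_form u) = (\<Sum>i\<in>UNIV. const (u $ i) * \<Phi> $ i)"
  by (simp add: linear_form_def subst_simps)

lemma map_comp_linear_map:
  "map_comp (linear_map A) \<Phi> = (\<chi> i. \<Sum>j\<in>UNIV. const (A $ i $ j) * \<Phi> $ j)"
  by (simp add: map_comp_def linear_map_def subst_linear_form)

lemma const_sum: "const (sum f A) = (\<Sum>x\<in>A. const (f x))"
  by (induction A rule: infinite_finite_induct) auto

lemma map_comp_linear_maps: "map_comp (linear_map A) (linear_map B) = linear_map (A ** B)"
proof -
  have "(\<Sum>j\<in>UNIV. const (A $ i $ j) * (\<Sum>k\<in>UNIV. const (B $ j $ k) * X $ k)) =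
        (\<Sum>k\<in>UNIV. (\<Sum>j\<in>UNIV. const (A $ i $ j) * const (B $ j $ k)) * X $ k)" for i
    by (simp add: sum_distrib_left sum_distrib_right mult.assoc) (rule sum.swap)
  then show ?thesis
    unfolding map_comp_linear_map
    by (simp add: vec_eq_iff linear_map_def linear_form_def matrix_matrix_mult_def const_sum)
qed

lemma linear_map_1 [simp]: "linear_map (mat 1) = X"
proof -
  have "(\<Sum>j\<in>UNIV. const (mat 1 $ i $ j) * X $ j) = (\<Sum>j\<in>UNIV. if i = j then X $ j else 0)" for i
    by (intro sum.cong) (auto simp: mat_def)
  then show ?thesis by (simp add: vec_eq_iff linear_map_def linear_form_def)
qed

text \<open>For \<open>s \<noteq> 0\<close> the triple \<open>scale s X\<close> represents the
  identity map; composites of mutually inverse maps are computed in this shape.\<close>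

definition scale :: "mpoly \<Rightarrow> mpoly ^ 3 \<Rightarrow> mpoly ^ 3" where
  "scale s \<Phi> = (\<chi> i. s * \<Phi> $ i)"

lemma scale_nth [simp]: "scale s \<Phi> $ i = s * \<Phi> $ i"
  by (simp add: scale_def)

lemma X_nonzero [simp]: "X $ i \<noteq> 0"
  using exhaust_3[of i] by (auto simp: X_def)

lemma X_nonzero' [simp]: "X \<noteq> 0"
  by (metis X_nonzero zero_index)

lemma same_map_scale: "s \<noteq> 0 \<Longrightarrow> same_map (scale s X) X"
  by (auto simp: same_map_def vec_eq_iff intro!: exI[of _ 1])

lemma linear_map_scale: "map_comp (linear_map A) (scale s \<Phi>) = scale s (map_comp (linear_map A) \<Phi>)"
  by (simp add: vec_eq_iff map_comp_linear_map sum_distrib_left mult_ac)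

lemma map_comp_scale_X: "map_comp (scale s X) \<Phi> = scale (subst \<Phi> s) \<Phi>"
  by (simp add: vec_eq_iff map_comp_def subst_simps)

text \<open>The case of \<open>de_jonquieres_form\<close> in which \<open>(g0 : g1)\<close> is the
  identity: an automorphism over \<open>K\<^sub>P\<close> fixes every line through the centre, so
  only the coordinate along the lines changes.\<close>

definition jonquieres :: "mpoly \<Rightarrow> mpoly \<Rightarrow> mpoly ^ 3" where
  "jonquieres q f = vector [q * X $ 1, q * X $ 2, f]"

lemma jonquieres_nth [simp]: "jonquieres q f $ 1 = q * X $ 1" "jonquieres q f $ 2 = q * X $ 2"
  "jonquieres q f $ 3 = f"
  by (simp_all add: jonquieres_def)

text \<open>
  The inverse of the fibrewise Moebius map \<open>x \<mapsto> (a x + b) / (c x + d)\<close> is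
  \<open>x \<mapsto> (d x - b) / (- c x + a)\<close>.
\<close>

lemma jonquieres_comp_inverse:
  assumes deg: "Polynomial.degree a = 0" "Polynomial.degree b = 0" "Polynomial.degree c = 0"
      "Polynomial.degree d = 0"
    and forms: "is_form m a" "is_form (m + 1) b" "is_form m d" "is_form (m - 1) c"
    and c: "m = 0 \<Longrightarrow> c = 0"
  shows "map_comp (jonquieres (c * X $ 3 + d) (a * X $ 3 + b))
             (jonquieres (- c * X $ 3 + a) (d * X $ 3 - b)) =
         scale ((- c * X $ 3 + a) ^ m * (a * d - b * c)) X"
proof -
  define q where "q = - c * X $ 3 + a"
  define f where "f = d * X $ 3 - b"
  \<comment> \<open>The map fixes \<open>(x0 : x1)\<close> up to the common factor \<open>q\<close>,
    so a form without \<open>x2\<close> only picks up a power of \<open>q\<close>.\<close>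
  have *: "subst (jonquieres q f) G = q ^ n * G"
    if "Polynomial.degree G = 0" "is_form n G" for G n
  proof -
    have "subst (jonquieres q f) G = subst (scale q X) G"
      by (intro degree_0_subst_cong that) simp_all
    also have "\<dots> = q ^ n * G"
      using subst_scale[OF that(2), of q X] by (simp add: scale_def)
    finally show ?thesis .
  qed
  \<comment> \<open>\<open>c\<close> has degree \<open>m - 1\<close>, one power of \<open>q\<close>
    short of \<open>a\<close> and \<open>d\<close>; the extra factor \<open>q\<close> evens this
    out. For \<open>m = 0\<close> the truncated subtraction would spoil the count, hence the
    assumption that \<open>c\<close> vanishes then.\<close>
  have c': "q * subst (jonquieres q f) c = q ^ m * c"
    using c *[OF deg(3) forms(4)] by (cases m) (auto simp: subst_simps)
  have eqs: "subst (jonquieres q f) a = q ^ m * a" "subst (jonquieres q f) b = q ^ (m + 1) * b"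
      "subst (jonquieres q f) d = q ^ m * d"
    using * deg forms by blast+
  have "subst (jonquieres q f) (c * X $ 3 + d) * q = (q * subst (jonquieres q f) c) * f + q ^ m * d * q"
    by (simp add: subst_simps eqs algebra_simps)
  also have "\<dots> = q ^ m * (a * d - b * c)"
    unfolding c' by (simp add: q_def f_def algebra_simps)
  finally have 1: "subst (jonquieres q f) (c * X $ 3 + d) * q = q ^ m * (a * d - b * c)" .
  have 2: "subst (jonquieres q f) (a * X $ 3 + b) = q ^ m * (a * d - b * c) * X $ 3"
    by (simp add: subst_simps eqs) (simp add: q_def f_def algebra_simps)
  have "map_comp (jonquieres (c * X $ 3 + d) (a * X $ 3 + b)) (jonquieres q f) =
      scale (q ^ m * (a * d - b * c)) X"
    using 1 2 by (simp add: vec_eq_iff forall_3 map_comp_def subst.mult mult.assoc[symmetric])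
  then show ?thesis by (simp only: q_def f_def)
qed

lemma linear_in_X3_decompose:
  assumes "is_form n q" "Polynomial.degree q \<le> 1"
  obtains c d where "q = c * X $ 3 + d" "Polynomial.degree c = 0" "Polynomial.degree d = 0"
    "is_form (n - 1) c" "is_form n d" "n = 0 \<Longrightarrow> c = 0"
    "c = [:Polynomial.coeff q 1:]" "d = [:Polynomial.coeff q 0:]"
proof
  let ?c = "[:Polynomial.coeff q 1:]" and ?d = "[:Polynomial.coeff q 0:]"
  show "q = ?c * X $ 3 + ?d"
  proof (rule poly_eqI)
    fix k show "Polynomial.coeff q k = Polynomial.coeff (?c * X $ 3 + ?d) k"
      using assms(2) coeff_eq_0[of q k]
      by (cases k; cases "k - 1") (auto simp: X_def coeff_pCons)
  qed
  show "is_form n ?d"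
    using assms(1) unfolding is_form_def by (metis add.right_neutral coeff_0 coeff_pCons_0 coeff_pCons_Suc not0_implies_Suc)
  have *: "i + j + 1 = n" if "Polynomial.coeff (Polynomial.coeff (Polynomial.coeff q 1) j) i \<noteq> 0"
    for i j using assms(1)[unfolded is_form_def, rule_format, OF that] .
  then show "is_form (n - 1) ?c"
    by (fastforce simp: is_form_def coeff_pCons split: nat.splits)
  show "?c = 0" if "n = 0"
  proof -
    have "Polynomial.coeff (Polynomial.coeff (Polynomial.coeff q 1) j) i = 0" for i j
      using * that by (metis add_is_0 one_neq_zero)
    then have "Polynomial.coeff q 1 = 0" by (auto intro!: poly_eqI)
    then show ?thesis by simp
  qed
qed simp_all

lemma subst_linear_map_inj:
  assumes "A ** B = mat 1" "subst (linear_map A) G = 0"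
  shows "G = 0"
proof -
  have "subst (linear_map B) (subst (linear_map A) G) = G"
    by (simp add: subst_subst map_comp_linear_maps assms(1))
  with assms(2) show ?thesis by (simp add: subst_simps)
qed

lemma is_form_linear_map [simp]: "is_form 1 (linear_map A $ i)"
  by (simp add: linear_map_def)

lemma is_form_linear_map' [simp]: "is_form (Suc 0) (linear_map A $ i)"
  by (simp add: linear_map_def)

lemma is_form_subst_linear_map: "is_form n G \<Longrightarrow> is_form n (subst (linear_map A) G)"
  using is_form_subst[of n G 1 "linear_map A"] by simp

text \<open>\<open>M\<close> leads to the coordinates in which \<open>\<Psi>\<close> is given, and
  \<open>N\<close>, intended as its inverse, leads back.\<close>

definition conjugate_by :: "complex ^ 3 ^ 3 \<Rightarrow> complex ^ 3 ^ 3 \<Rightarrow> mpoly ^ 3 \<Rightarrow> mpoly ^ 3" where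
  "conjugate_by N M \<Psi> = map_comp (linear_map N) (map_comp \<Psi> (linear_map M))"

lemma is_form_conjugate:
  assumes "\<And>i. is_form n (\<Psi> $ i)"
  shows "is_form n (conjugate_by N M \<Psi> $ i)"
proof -
  have "is_form n (map_comp \<Psi> (linear_map M) $ j)" for j
    using assms by (simp add: map_comp_def is_form_subst_linear_map)
  then have "is_form (0 + n) (const x * map_comp \<Psi> (linear_map M) $ j)" for x j
    by (intro is_form_mult) simp_all
  then show ?thesis
    by (auto simp: conjugate_by_def map_comp_linear_map)
qed

lemma conjugate_comp:
  assumes "M ** N = mat 1" "map_comp \<Psi> \<Psi>' = scale s X"
  shows "map_comp (conjugate_by N M \<Psi>) (conjugate_by N M \<Psi>') = scale (subst (linear_map M) s) X"
proof -
  have NM: "N ** M = mat 1" using assms(1) by (simp add: matrix_left_right_inverse)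
  have "map_comp (conjugate_by N M \<Psi>) (conjugate_by N M \<Psi>') =
      map_comp (linear_map N) (map_comp \<Psi> (map_comp (map_comp (linear_map M) (linear_map N))
        (map_comp \<Psi>' (linear_map M))))"
    by (simp add: conjugate_by_def map_comp_assoc)
  also have "map_comp (linear_map M) (linear_map N) = X"
    by (simp add: map_comp_linear_maps assms)
  also have "map_comp X (map_comp \<Psi>' (linear_map M)) = map_comp \<Psi>' (linear_map M)"
    by (simp add: vec_eq_iff map_comp_def)
  also have "map_comp \<Psi> (map_comp \<Psi>' (linear_map M)) = scale (subst (linear_map M) s) (linear_map M)"
    by (simp add: map_comp_assoc[symmetric] assms(2) map_comp_scale_X)
  finally show ?thesis by (simp add: linear_map_scale map_comp_linear_maps NM)
qed

lemma map_comp_0 [simp]: "map_comp 0 \<Phi> = 0"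
  by (simp add: vec_eq_iff map_comp_def subst_simps)

text \<open>The determinant condition makes the fibrewise Moebius map invertible over the rational
  functions in \<open>x0, x1\<close>. The adjugate matrix gives the inverse
  \<open>jonquieres q' f'\<close>, and conjugation keeps both composites multiples of
  \<open>X\<close>.\<close>

theorem de_jonquieres_conjugate:
  assumes q: "is_form m q" "Polynomial.degree q \<le> 1"
    and f: "is_form (m + 1) f" "Polynomial.degree f \<le> 1"
    and "coprime q f"
    and det: "Polynomial.coeff f 1 * Polynomial.coeff q 0 \<noteq> Polynomial.coeff f 0 * Polynomial.coeff q 1"
    and MN: "M ** N = mat 1"
  shows "de_jonquieres (conjugate_by N M (jonquieres q f))"
proof -
  have NM: "N ** M = mat 1" using MN by (simp add: matrix_left_right_inverse)
  from linear_in_X3_decompose[OF q] obtain c d where cd: "q = c * X $ 3 + d"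
    "Polynomial.degree c = 0" "Polynomial.degree d = 0"
    "is_form (m - 1) c" "is_form m d" "m = 0 \<Longrightarrow> c = 0"
    "c = [:Polynomial.coeff q 1:]" "d = [:Polynomial.coeff q 0:]" by metis
  from linear_in_X3_decompose[OF f] obtain a b where ab: "f = a * X $ 3 + b"
    "Polynomial.degree a = 0" "Polynomial.degree b = 0"
    "is_form m a" "is_form (m + 1) b"
    "a = [:Polynomial.coeff f 1:]" "b = [:Polynomial.coeff f 0:]"
    by (metis diff_add_inverse2)
  have det': "a * d - b * c \<noteq> 0" using det by (simp add: ab(6,7) cd(7,8) mult.commute)
  define q' f' where "q' = - c * X $ 3 + a" and "f' = d * X $ 3 - b"
  define \<Psi> \<Psi>' where "\<Psi> = jonquieres q f" and "\<Psi>' = jonquieres q' f'"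
  have linear_0: "u = 0 \<and> v = 0" if "u * X $ 3 + v = 0"
    "Polynomial.degree u = 0" "Polynomial.degree v = 0" for u v :: mpoly
    using that by (auto simp: X_def elim!: degree_eq_zeroE)
  have "q \<noteq> 0"
    using linear_0[OF _ cd(2,3)] det' unfolding cd(1) by force
  have "Polynomial.degree (- c) = 0" by (simp add: cd(2))
  then have "q' \<noteq> 0"
    using linear_0[OF _ _ ab(2), of "- c"] det' unfolding q'_def by force
  have 1: "map_comp \<Psi> \<Psi>' = scale (q' ^ m * (a * d - b * c)) X"
    using jonquieres_comp_inverse[OF ab(2,3) cd(2,3) ab(4,5) cd(5,4,6)]
    by (simp only: \<Psi>_def \<Psi>'_def q'_def f'_def ab(1)[symmetric] cd(1)[symmetric])
  \<comment> \<open>The same identity for the adjugate entries \<open>d, - b, - c, a\<close>, whose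
    own adjugate is the original matrix.\<close>
  have "map_comp \<Psi>' \<Psi> =
      scale ((- (- c) * X $ 3 + d) ^ m * (d * a - (- b) * (- c))) X"
    using jonquieres_comp_inverse[of d "- b" "- c" a m] ab(2-5) cd(2-6)
    by (simp only: \<Psi>_def \<Psi>'_def q'_def f'_def ab(1)[symmetric] cd(1)[symmetric]
        is_form_uminus degree_minus minus_minus neg_equal_0_iff_equal
        diff_minus_eq_add diff_conv_add_uminus)
  then have 2: "map_comp \<Psi>' \<Psi> = scale (q ^ m * (a * d - b * c)) X"
    by (simp only: cd(1)[symmetric] minus_minus minus_mult_minus mult.commute)
  have forms: "is_form (m + 1) (\<Psi> $ i)" for i
    using exhaust_3[of i] is_form_mult[OF q(1) is_form_X] f(1) by (auto simp: \<Psi>_def)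
  have q': "is_form m q'"
  proof (cases m)
    case (Suc k)
    then have "is_form (k + 1) (c * X $ 3)" using cd by (intro is_form_mult) auto
    with Suc ab show ?thesis by (auto simp: q'_def)
  qed (use ab cd in \<open>auto simp: q'_def\<close>)
  have "is_form (m + 1) f'"
    unfolding f'_def by (intro is_form_diff is_form_mult cd(5) ab(5) is_form_X)
  then have forms': "is_form (m + 1) (\<Psi>' $ i)" for i
    using exhaust_3[of i] is_form_mult[OF q' is_form_X] by (auto simp: \<Psi>'_def)
  define \<Phi> \<Phi>' where "\<Phi> = conjugate_by N M \<Psi>" and "\<Phi>' = conjugate_by N M \<Psi>'"
  have T: "subst (linear_map M) G \<noteq> 0" if "G \<noteq> 0" for G
    using subst_linear_map_inj[OF MN] that by blast
  have "q' ^ m * (a * d - b * c) \<noteq> 0" "q ^ m * (a * d - b * c) \<noteq> 0"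
    using \<open>q \<noteq> 0\<close> \<open>q' \<noteq> 0\<close> det' by (metis mult_eq_0_iff power_not_zero)+
  then have 3: "same_map (map_comp \<Phi> \<Phi>') X" "same_map (map_comp \<Phi>' \<Phi>) X"
    unfolding \<Phi>_def \<Phi>'_def conjugate_comp[OF MN 1] conjugate_comp[OF MN 2]
    by - (intro same_map_scale T; assumption)+
  then have "map_comp \<Phi> \<Phi>' \<noteq> 0" "map_comp \<Phi>' \<Phi> \<noteq> 0"
    unfolding same_map_def by blast+
  then have "\<Phi> \<noteq> 0" "\<Phi>' \<noteq> 0" using map_comp_0 by metis+
  then have "rational_map \<Phi>" "rational_map \<Phi>'"
    using is_form_conjugate forms forms' unfolding rational_map_def \<Phi>_def \<Phi>'_def by blast+
  with 3 have cremona: "cremona \<Phi>" by (auto simp: cremona_def)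
  define I where "I = (vector [X $ 1, X $ 2, 0] :: mpoly ^ 3)"
  have "I \<noteq> 0" "map_comp I I = I"
    by (simp_all add: vec_eq_iff forall_3 I_def map_comp_def subst_simps)
  then have "same_map (map_comp I I) I"
    by (simp add: same_map_def mult.commute)
  then have "birational_on_line 1 (X $ 1) (X $ 2)"
    unfolding birational_on_line_def I_def using binary_form_X by blast
  \<comment> \<open>If neither form involved \<open>X $ 3\<close>, both products in
    \<open>det\<close> would be zero.\<close>
  moreover have "Polynomial.degree q = 1 \<or> Polynomial.degree f = 1"
  proof (rule ccontr)
    assume "\<not> ?thesis"
    with q(2) f(2) have "Polynomial.degree q = 0" "Polynomial.degree f = 0" by linarith+
    with det show False by (simp add: coeff_eq_0)
  qed
  ultimately have form: "de_jonquieres_form \<Psi>"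
    unfolding de_jonquieres_form_def \<Psi>_def jonquieres_def
    using q f \<open>coprime q f\<close> by blast
  have "map_comp (linear_map M) \<Phi> =
      map_comp (map_comp (linear_map M) (linear_map N)) (map_comp \<Psi> (linear_map M))"
    by (simp add: \<Phi>_def conjugate_by_def map_comp_assoc)
  also have "\<dots> = map_comp \<Psi> (linear_map M)"
    unfolding map_comp_linear_maps MN linear_map_1 by (simp add: vec_eq_iff map_comp_def)
  finally have M\<Phi>: "map_comp (linear_map M) \<Phi> = map_comp \<Psi> (linear_map M)" .
  have "map_comp \<Psi> (linear_map M) $ 1 \<noteq> 0"
    using T[of "q * X $ 1"] \<open>q \<noteq> 0\<close> by (simp add: \<Psi>_def map_comp_def)
  then have "map_comp \<Psi> (linear_map M) \<noteq> 0" by (metis zero_index)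
  then have "same_map (map_comp (linear_map M) \<Phi>) (map_comp \<Psi> (linear_map M))"
    unfolding M\<Phi> by (simp add: same_map_def mult.commute)
  with cremona form MN NM show ?thesis
    unfolding de_jonquieres_def \<Phi>_def[symmetric] \<Psi>_def[symmetric] invertible_def by blast
qed

section \<open>The function field of a plane curve\<close>

locale plane_curve =
  fixes F :: mpoly and d :: nat
  assumes curve: "irreducible_plane_curve d F"
begin

abbreviation LR where "LR \<equiv> carrier (local_ring F)"
abbreviation I where "I \<equiv> vanishing_ideal F"

definition res :: "mpoly fract \<Rightarrow> mpoly fract set" where
  "res x = I +>\<^bsub>local_ring F\<^esub> x"

lemma F_form: "is_form d F"
  using curve by (simp add: irreducible_plane_curve_def)

lemma F_prime: "prime_elem F"
  using curve by (simp add: irreducible_plane_curve_def irreducible_imp_prime_elem)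

lemma F_dvd_mult_iff: "F dvd G * H \<longleftrightarrow> F dvd G \<or> F dvd H"
  using F_prime by (rule prime_elem_dvd_mult_iff)

lemma F_dvd_power: "F dvd G ^ n \<Longrightarrow> F dvd G"
  using F_prime by (rule prime_elem_dvd_power)

lemma F_not_dvd_1: "\<not> F dvd 1"
  using F_prime by (simp add: prime_elem_def)

lemma local_ring_simps [simp]:
  "x \<otimes>\<^bsub>local_ring F\<^esub> y = x * y" "x \<oplus>\<^bsub>local_ring F\<^esub> y = x + y"
  "\<one>\<^bsub>local_ring F\<^esub> = 1" "\<zero>\<^bsub>local_ring F\<^esub> = 0"
  by (simp_all add: local_ring_def)

lemma LR_iff: "x \<in> LR \<longleftrightarrow> (\<exists>G H n. x = Fract G H \<and> is_form n G \<and> is_form n H \<and> \<not> F dvd H)"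
  by (auto simp: local_ring_def)

lemma LR_E:
  assumes "x \<in> LR"
  obtains G H n where "x = Fract G H" "is_form n G" "is_form n H" "\<not> F dvd H" "H \<noteq> 0"
  using assms unfolding LR_iff by (metis dvd_0_right)

lemma Fract_in_LR: "is_form n G \<Longrightarrow> is_form n H \<Longrightarrow> \<not> F dvd H \<Longrightarrow> Fract G H \<in> LR"
  by (auto simp: LR_iff)

text \<open>Independence of the chosen fraction follows by cross multiplication and primality of
  \<open>F\<close>.\<close>

lemma I_iff:
  assumes "is_form n G" "is_form n H" "\<not> F dvd H"
  shows "Fract G H \<in> I \<longleftrightarrow> F dvd G"
proof
  assume "Fract G H \<in> I"
  then obtain G' H' where *: "Fract G H = Fract G' H'" "\<not> F dvd H'" "F dvd G'"
    by (auto simp: vanishing_ideal_def)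
  then have "G * H' = G' * H"
    using assms(3) by (metis eq_fract(1) dvd_0_right)
  then have "F dvd G * H'" using * by simp
  with *(2) show "F dvd G" by (simp add: F_dvd_mult_iff)
qed (use assms in \<open>auto simp: vanishing_ideal_def\<close>)

lemma I_E:
  assumes "x \<in> I"
  obtains G H n where "x = Fract G H" "is_form n G" "is_form n H" "\<not> F dvd H" "H \<noteq> 0" "F dvd G"
  using assms unfolding vanishing_ideal_def by (auto; metis dvd_0_right)

lemma I_subset_LR: "x \<in> I \<Longrightarrow> x \<in> LR"
  by (auto simp: vanishing_ideal_def LR_iff)

lemma LR_add: assumes "x \<in> LR" "y \<in> LR" shows "x + y \<in> LR"
proof -
  from assms(1) obtain G H n where 1: "x = Fract G H" "is_form n G" "is_form n H" "\<not> F dvd H" "H \<noteq> 0"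
    by (rule LR_E)
  from assms(2) obtain G' H' n' where
    2: "y = Fract G' H'" "is_form n' G'" "is_form n' H'" "\<not> F dvd H'" "H' \<noteq> 0"
    by (rule LR_E)
  have "is_form (n + n') (G * H' + G' * H)"
    using 1 2 is_form_mult[of n G n' H'] is_form_mult[of n' G' n H]
    by (intro is_form_add) (simp_all add: add.commute)
  with 1 2 show ?thesis
    by (auto simp: F_dvd_mult_iff intro!: Fract_in_LR[of "n + n'"])
qed

lemma LR_mult: assumes "x \<in> LR" "y \<in> LR" shows "x * y \<in> LR"
  using assms by (auto elim!: LR_E simp: F_dvd_mult_iff intro!: Fract_in_LR[OF is_form_mult is_form_mult])

lemma LR_uminus: "x \<in> LR \<Longrightarrow> - x \<in> LR"
  by (auto elim!: LR_E intro!: Fract_in_LR)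

lemma LR_diff: "x \<in> LR \<Longrightarrow> y \<in> LR \<Longrightarrow> x - y \<in> LR"
  using LR_add[of x "- y"] LR_uminus[of y] by simp

lemma LR_const: "Fract (const c) 1 \<in> LR"
  using F_not_dvd_1 by (intro Fract_in_LR[of 0]) auto

lemma LR_0: "0 \<in> LR" and LR_1: "1 \<in> LR"
  using LR_const[of 0] LR_const[of 1] by (simp_all add: Zero_fract_def One_fract_def)

lemmas LR_closed = LR_add LR_mult LR_uminus LR_diff LR_0 LR_1

lemma I_add: assumes "x \<in> I" "y \<in> I" shows "x + y \<in> I"
proof -
  from assms(1) obtain G H n where
    1: "x = Fract G H" "is_form n G" "is_form n H" "\<not> F dvd H" "H \<noteq> 0" "F dvd G"
    by (rule I_E)
  from assms(2) obtain G' H' n' where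
    2: "y = Fract G' H'" "is_form n' G'" "is_form n' H'" "\<not> F dvd H'" "H' \<noteq> 0" "F dvd G'"
    by (rule I_E)
  have "is_form (n + n') (G * H' + G' * H)"
    using 1 2 is_form_mult[of n G n' H'] is_form_mult[of n' G' n H]
    by (intro is_form_add) (simp_all add: add.commute)
  moreover have "is_form (n + n') (H * H')" using 1 2 by auto
  ultimately show ?thesis
    using 1 2 by (simp add: I_iff[of "n + n'"] F_dvd_mult_iff)
qed

text \<open>Primality of \<open>F\<close> makes \<open>I\<close> a prime ideal, so factors can be
  cancelled modulo \<open>I\<close> without inverses in the function field.\<close>

lemma I_mult_iff:
  assumes "x \<in> LR" "y \<in> LR"
  shows "x * y \<in> I \<longleftrightarrow> x \<in> I \<or> y \<in> I"
proof -
  from assms(1) obtain G H n where 1: "x = Fract G H" "is_form n G" "is_form n H" "\<not> F dvd H"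
    by (rule LR_E)
  from assms(2) obtain G' H' n' where
    2: "y = Fract G' H'" "is_form n' G'" "is_form n' H'" "\<not> F dvd H'"
    by (rule LR_E)
  have "is_form (n + n') (G * G')" "is_form (n + n') (H * H')" using 1 2 by auto
  with 1 2 show ?thesis by (simp add: I_iff F_dvd_mult_iff)
qed

lemma I_uminus: "x \<in> I \<Longrightarrow> - x \<in> I"
  using I_mult_iff[of "- 1" x] I_subset_LR[of x] LR_closed by simp

lemma I_diff: "x \<in> I \<Longrightarrow> y \<in> I \<Longrightarrow> x - y \<in> I"
  using I_add[of x "- y"] I_uminus[of y] by simp

lemma I_0: "0 \<in> I"
  using I_iff[of 0 0 1] F_not_dvd_1 by (simp add: Zero_fract_def)

lemma I_1: "1 \<notin> I"
  using I_iff[of 0 1 1] F_not_dvd_1 by (simp add: One_fract_def)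

lemma cring_local_ring: "cring (local_ring F)"
proof (rule cringI)
  show "abelian_group (local_ring F)"
  proof (rule abelian_groupI)
    fix x assume "x \<in> LR"
    then show "\<exists>y\<in>LR. y \<oplus>\<^bsub>local_ring F\<^esub> x = \<zero>\<^bsub>local_ring F\<^esub>"
      by (intro bexI[of _ "- x"]) (auto intro: LR_uminus)
  qed (auto intro: LR_closed)
  show "Group.comm_monoid (local_ring F)"
    by (rule comm_monoidI) (auto intro: LR_closed)
qed (auto simp: distrib_right)

interpretation local_ring: cring "local_ring F"
  by (rule cring_local_ring)

lemma local_ring_diff: "x \<in> LR \<Longrightarrow> y \<in> LR \<Longrightarrow> x \<ominus>\<^bsub>local_ring F\<^esub> y = x - y"
  using local_ring.minus_equality[of "- y" y] LR_uminus[of y] by (simp add: a_minus_def)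

lemma ideal_I: "ideal I (local_ring F)"
proof (rule idealI)
  show "subgroup I (add_monoid (local_ring F))"
  proof (rule local_ring.add.subgroupI)
    fix x assume x: "x \<in> I"
    then have "\<ominus>\<^bsub>local_ring F\<^esub> x = - x"
      using local_ring.minus_equality[of "- x" x] I_subset_LR LR_uminus by simp
    then show "\<ominus>\<^bsub>local_ring F\<^esub> x \<in> I"
      using x by (simp add: I_uminus)
  qed (use I_subset_LR I_0 I_add in auto)
qed (auto simp: I_mult_iff I_subset_LR local_ring.ring_axioms)

text \<open>The bridge between cosets and congruences: from here on, equalities in the function
  field are statements about fractions modulo \<open>I\<close>.\<close>

lemma res_eq_iff: "x \<in> LR \<Longrightarrow> y \<in> LR \<Longrightarrow> res x = res y \<longleftrightarrow> x - y \<in> I"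
  using local_ring.quotient_eq_iff_same_a_r_cos[OF ideal_I] by (simp add: res_def local_ring_diff)

lemma res_hom: "res \<in> ring_hom (local_ring F) (function_field F)"
  using ideal.rcos_ring_hom[OF ideal_I] unfolding res_def function_field_def .

lemma carrier_function_field: "carrier (function_field F) = res ` LR"
  by (auto simp: function_field_def FactRing_def A_RCOSETS_def' res_def)

lemma rat_fun_res: "rat_fun F G H = res (Fract G H)"
  by (simp add: rat_fun_def res_def)

end

section \<open>Automorphisms of the function field\<close>

lemma Fract_power: "Fract a b ^ n = Fract (a ^ n) (b ^ n)"
  by (induction n) (simp_all add: One_fract_def)

lemma Fract_add_same: "b \<noteq> 0 \<Longrightarrow> Fract (a + c) b = Fract a b + Fract c b"
  by (simp add: Fract_conv_to_fract add_divide_distrib)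

locale plane_curve_endo = plane_curve +
  fixes \<sigma> :: "mpoly fract set \<Rightarrow> mpoly fract set"
  assumes \<sigma>_hom: "\<sigma> \<in> ring_hom (function_field F) (function_field F)"
    and \<sigma>_inj: "inj_on \<sigma> (carrier (function_field F))"
    and \<sigma>_const: "\<sigma> (res (Fract (const c) 1)) = res (Fract (const c) 1)"
begin

text \<open>A relation rather than a function on representatives, since the image under
  \<open>\<sigma>\<close> is determined only modulo \<open>I\<close>.\<close>

definition lifts :: "mpoly fract \<Rightarrow> mpoly fract \<Rightarrow> bool" where
  "lifts u v \<longleftrightarrow> u \<in> LR \<and> v \<in> LR \<and> \<sigma> (res u) = res v"

lemma res_in: "u \<in> LR \<Longrightarrow> res u \<in> carrier (function_field F)"
  by (simp add: carrier_function_field)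

lemma lifts_const: "lifts (Fract (const c) 1) (Fract (const c) 1)"
  by (simp add: lifts_def LR_const \<sigma>_const)

lemma lifts_0: "lifts 0 0" and lifts_1: "lifts 1 1"
  using lifts_const[of 0] lifts_const[of 1] by (simp_all add: Zero_fract_def One_fract_def)

lemma lifts_add:
  assumes "lifts u v" "lifts u' v'"
  shows "lifts (u + u') (v + v')"
proof -
  have res: "res (x + y) = res x \<oplus>\<^bsub>function_field F\<^esub> res y" if "x \<in> LR" "y \<in> LR" for x y
    using ring_hom_add[OF res_hom that] by simp
  show ?thesis
    using assms ring_hom_add[OF \<sigma>_hom] by (simp add: lifts_def res res_in LR_add)
qed

lemma lifts_mult:
  assumes "lifts u v" "lifts u' v'"
  shows "lifts (u * u') (v * v')"
proof -
  have res: "res (x * y) = res x \<otimes>\<^bsub>function_field F\<^esub> res y" if "x \<in> LR" "y \<in> LR" for x y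
    using ring_hom_mult[OF res_hom that] by simp
  show ?thesis
    using assms ring_hom_mult[OF \<sigma>_hom] by (simp add: lifts_def res res_in LR_mult)
qed

lemma lifts_uminus: "lifts u v \<Longrightarrow> lifts (- u) (- v)"
  using lifts_mult[OF lifts_const[of "- 1"], of u v]
  by (simp add: Fract_conv_to_fract const_def[of 1] one_pCons[symmetric])

lemma lifts_diff: "lifts u v \<Longrightarrow> lifts u' v' \<Longrightarrow> lifts (u - u') (v - v')"
  using lifts_add[of u v "- u'" "- v'"] lifts_uminus[of u' v'] by simp

lemma lifts_power: "lifts u v \<Longrightarrow> lifts (u ^ n) (v ^ n)"
  by (induction n) (auto intro: lifts_mult lifts_1)

lemma lifts_cong:
  assumes "lifts u v" "u - u' \<in> I" "v - v' \<in> I" "u' \<in> LR" "v' \<in> LR"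
  shows "lifts u' v'"
  using assms by (simp add: lifts_def flip: res_eq_iff)

lemma lifts_unique:
  assumes "lifts u v" "lifts u v'"
  shows "v - v' \<in> I"
  using assms by (auto simp: lifts_def simp flip: res_eq_iff)

lemma lifts_exists:
  assumes "u \<in> LR"
  obtains v where "lifts u v"
proof -
  have "\<sigma> (res u) \<in> res ` LR"
    using ring_hom_closed[OF \<sigma>_hom res_in[OF assms]] by (simp add: carrier_function_field)
  with assms that show ?thesis by (auto simp: lifts_def)
qed

text \<open>Injectivity of \<open>\<sigma>\<close> gives the direction from right to left, which
  later keeps denominators from vanishing after substitution.\<close>

lemma lifts_I_iff:
  assumes "lifts u v"
  shows "u \<in> I \<longleftrightarrow> v \<in> I"
proof -
  have uv: "u \<in> LR" "v \<in> LR" "\<sigma> (res u) = res v" and 0: "\<sigma> (res 0) = res 0"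
    using assms lifts_0 by (auto simp: lifts_def)
  have "u \<in> I \<longleftrightarrow> res u = res 0"
    using res_eq_iff[of u 0] uv LR_0 by simp
  also have "\<dots> \<longleftrightarrow> \<sigma> (res u) = \<sigma> (res 0)"
    using inj_on_eq_iff[OF \<sigma>_inj] res_in uv LR_0 by metis
  also have "\<dots> \<longleftrightarrow> v \<in> I"
    using res_eq_iff[of v 0] uv LR_0 0 by simp
  finally show ?thesis .
qed

text \<open>The three functions \<open>X $ i / l\<close> generate the function field over the
  constants: a form of degree \<open>n\<close> divided by \<open>l ^ n\<close> is a polynomial in
  them, and \<open>G / H\<close> is a quotient of two such. So agreement on these generators is
  enough.\<close>

theorem inducesI:
  assumes forms: "\<And>i. is_form N (\<Phi> $ i)"
    and l: "l = linear_form w" "\<not> F dvd l" "\<not> F dvd subst \<Phi> l"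
    and gens: "\<And>i. lifts (Fract (X $ i) l) (Fract (\<Phi> $ i) (subst \<Phi> l))"
  shows "induces F \<Phi> \<sigma>"
proof -
  define S where "S = subst \<Phi>"
  have nz: "l \<noteq> 0" "S l \<noteq> 0" using l(2,3) by (auto simp: S_def)
  have l_form: "is_form (1 * n) (l ^ n)" for n
    unfolding l(1) by (intro is_form_power is_form_linear_form)
  have S_form: "is_form (N * n) (S G)" if "is_form n G" for n G
    unfolding S_def by (intro is_form_subst that forms)
  have Sl_form: "is_form (N * n) (S l ^ n)" for n
    using S_form[OF l_form[of n]] by (simp add: S_def subst_simps)
  have lifts_form: "lifts (Fract G (l ^ n)) (Fract (S G) (S l ^ n))" if "is_form n G" for n G
    using that
  proof (induction rule: form_induct)
    case zero
    show ?case using lifts_0 by (simp add: S_def subst_simps Fract_conv_to_fract)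
  next
    case (monom3 c i j k)
    have eq: "Fract (const c * G1 ^ i * G2 ^ j * G3 ^ k) (h ^ n) =
        Fract (const c) 1 * Fract G1 h ^ i * Fract G2 h ^ j * Fract G3 h ^ k"
      for G1 G2 G3 h :: mpoly
      using monom3 by (auto simp: Fract_power power_add)
    show ?case
      unfolding monom3_eq S_def subst_simps subst_const subst_X eq
      by (intro lifts_mult lifts_power gens lifts_const)
  next
    case (add G H)
    have nz': "l ^ n \<noteq> 0" "S l ^ n \<noteq> 0" using nz by simp_all
    have "S (G + H) = S G + S H" by (simp add: S_def subst.add)
    then show ?case
      unfolding Fract_add_same[OF nz'(1)] using lifts_add[OF add.IH]
      by (simp only: Fract_add_same[OF nz'(2)])
  qed
  \<comment> \<open>Divisibility by \<open>F\<close> is membership of \<open>G / l ^ n\<close> in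
    \<open>I\<close>, which \<open>\<sigma>\<close> preserves and reflects. Applied to
    \<open>F\<close> itself this shows that the triple maps the curve to itself.\<close>
  have dvd_iff: "F dvd G \<longleftrightarrow> F dvd S G" if "is_form n G" for n G
  proof -
    have "\<not> F dvd l ^ n" "\<not> F dvd S l ^ n"
      using F_dvd_power l(2,3) by (auto simp: S_def)
    with lifts_I_iff[OF lifts_form[OF that]] show ?thesis
      using I_iff[OF that] l_form[of n] I_iff[OF S_form[OF that] Sl_form] by simp
  qed
  have "\<sigma> (rat_fun F G H) = rat_fun F (S G) (S H)"
    if G: "is_form n G" and H: "is_form n H" "\<not> F dvd H" for n G H
  proof -
    have SH: "\<not> F dvd S H" using dvd_iff[OF H(1)] H(2) by simp
    then have nz': "H \<noteq> 0" "S H \<noteq> 0" using H(2) by auto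
    have GH: "Fract G H \<in> LR" by (intro Fract_in_LR[OF G H])
    have SGH: "Fract (S G) (S H) \<in> LR"
      by (rule Fract_in_LR[OF S_form[OF G] S_form[OF H(1)] SH])
    from lifts_exists[OF GH] obtain w where w: "lifts (Fract G H) w" .
    \<comment> \<open>Division is avoided: \<open>G / H\<close> is characterised by its product with
      \<open>H / l ^ n\<close>, and the image of that factor, which is not in \<open>I\<close>, is
      cancelled below.\<close>
    have "Fract G (l ^ n) = Fract G H * Fract H (l ^ n)"
      using nz nz' by (simp add: eq_fract)
    with lifts_mult[OF w lifts_form[OF H(1)]] lifts_form[OF G]
    have "w * Fract (S H) (S l ^ n) - Fract (S G) (S l ^ n) \<in> I"
      using lifts_unique by metis
    also have "w * Fract (S H) (S l ^ n) - Fract (S G) (S l ^ n) =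
        (w - Fract (S G) (S H)) * Fract (S H) (S l ^ n)"
      using nz nz' by (simp add: left_diff_distrib eq_fract)
    finally have "w - Fract (S G) (S H) \<in> I \<or> Fract (S H) (S l ^ n) \<in> I"
      using lifts_form[OF H(1)] w SGH by (subst (asm) I_mult_iff) (auto simp: lifts_def LR_diff)
    moreover have "Fract (S H) (S l ^ n) \<notin> I"
      using I_iff[OF S_form[OF H(1)] Sl_form] SH l(3) F_dvd_power by (auto simp: S_def)
    ultimately have "res w = res (Fract (S G) (S H))"
      using w SGH by (subst res_eq_iff) (auto simp: lifts_def)
    with w show ?thesis by (simp add: rat_fun_res lifts_def)
  qed
  note on_functions = this
  have nonzero: "\<exists>i. \<not> F dvd \<Phi> $ i"
  proof (rule ccontr)
    assume "\<not> ?thesis"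
    then have "F dvd subst \<Phi> l"
      unfolding l(1) subst_linear_form by (intro dvd_sum) auto
    with l(3) show False by simp
  qed
  then have "\<Phi> \<noteq> 0" by auto
  then have "rational_map \<Phi>" using forms by (auto simp: rational_map_def)
  moreover have "F dvd S F" using dvd_iff[OF F_form] by simp
  moreover have "\<not> F dvd S H" if "is_form n H" "\<not> F dvd H" for n H
    using dvd_iff[OF that(1)] that(2) by simp
  ultimately show ?thesis
    using nonzero on_functions unfolding induces_def S_def[symmetric] by blast
qed

end

section \<open>Reduction of a fibrewise Moebius map to coprime coefficients\<close>

lemma coeff_linear_X3:
  assumes "Polynomial.degree u = 0" "Polynomial.degree v = 0"
  shows "Polynomial.coeff (u * X $ 3 + v) 1 = Polynomial.coeff u 0"
    "Polynomial.coeff (u * X $ 3 + v) 0 = Polynomial.coeff v 0"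
    "Polynomial.degree (u * X $ 3 + v) \<le> 1"
  using assms by (auto simp: X_def elim!: degree_eq_zeroE)

lemma linear_X3_eq_0:
  assumes "u * X $ 3 + v = 0" "Polynomial.degree u = 0" "Polynomial.degree v = 0"
  shows "u = 0" "v = 0"
  using coeff_linear_X3(1,2)[OF assms(2,3)] assms by (auto elim!: degree_eq_zeroE)

text \<open>In the coordinate \<open>X $ 3 / X $ 1\<close> the Moebius map is
  \<open>(A * X $ 3 + B * X $ 1) / (C * X $ 3 + D * X $ 1)\<close>, while
  \<open>jonquieres q f\<close> sends that coordinate to \<open>f / (q * X $ 1)\<close>; hence the
  extra factor \<open>X $ 1\<close> in \<open>f * g\<close>. The divisibility of \<open>g\<close> is
  exported to show that cancelling it is harmless on the curve.\<close>

lemma moebius_reduction: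
  assumes bin: "binary_form n A" "binary_form n B" "binary_form n C" "binary_form n D"
    and det: "A * D - B * C \<noteq> 0"
  obtains g q f m where "C * X $ 3 + D * X $ 1 = q * g" "X $ 1 * (A * X $ 3 + B * X $ 1) = f * g"
    "g dvd X $ 1 ^ 2 * (A * D - B * C)" "coprime q f" "is_form m q" "is_form (m + 1) f"
    "Polynomial.degree q \<le> 1" "Polynomial.degree f \<le> 1"
    "Polynomial.coeff f 1 * Polynomial.coeff q 0 \<noteq> Polynomial.coeff f 0 * Polynomial.coeff q 1"
proof -
  have deg: "Polynomial.degree A = 0" "Polynomial.degree B = 0" "Polynomial.degree C = 0"
    "Polynomial.degree D = 0" and forms: "is_form n A" "is_form n B" "is_form n C" "is_form n D"
    using bin by (auto simp: binary_form_def)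
  define x where "x = X $ 1"
  have x: "x \<noteq> 0" "Polynomial.degree x = 0" "is_form 1 x" by (simp_all add: x_def)
  define q0 where "q0 = C * X $ 3 + D * x"
  define f0 where "f0 = (x * A) * X $ 3 + x * B * x"
  have deg': "Polynomial.degree (D * x) = 0" "Polynomial.degree (x * A) = 0"
    "Polynomial.degree (x * B * x) = 0"
    using deg x by (simp_all add: degree_mult_0)
  \<comment> \<open>Elimination of \<open>X $ 3\<close>: every common divisor of \<open>q0\<close>
    and \<open>f0\<close> divides a nonzero element free of \<open>X $ 3\<close>, so the gcd is free
    of \<open>X $ 3\<close> too.\<close>
  have *: "A * x * q0 - C * f0 = x ^ 2 * (A * D - B * C)"
    by (simp add: q0_def f0_def algebra_simps power2_eq_square)
  have \<Delta>: "x ^ 2 * (A * D - B * C) \<noteq> 0"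
    using det x(1) by (metis mult_eq_0_iff power_not_zero)
  have "q0 \<noteq> 0"
  proof
    assume "q0 = 0"
    then have "C = 0" "D * x = 0" using linear_X3_eq_0 deg deg' unfolding q0_def by blast+
    with x(1) det show False by simp
  qed
  have "f0 \<noteq> 0"
  proof
    assume "f0 = 0"
    then have "x * A = 0" "x * B * x = 0" using linear_X3_eq_0 deg' unfolding f0_def by blast+
    with x(1) det show False by simp
  qed
  define g where "g = gcd q0 f0"
  have "g \<noteq> 0" using \<open>q0 \<noteq> 0\<close> by (simp add: g_def)
  then obtain q f where qf: "q0 = q * g" "f0 = f * g" "coprime q f"
    unfolding g_def by (metis gcd_coprime_exists)
  have g_dvd: "g dvd x ^ 2 * (A * D - B * C)"
    unfolding *[symmetric] by (simp add: qf)
  have "Polynomial.degree (A * D - B * C) = 0"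
    using degree_diff_le_max[of "A * D" "B * C"] deg by (simp add: degree_mult_0)
  then have deg_\<Delta>: "Polynomial.degree (x ^ 2 * (A * D - B * C)) = 0"
    using x(2) by (simp add: power2_eq_square degree_mult_0)
  then have "Polynomial.degree g = 0"
    using dvd_imp_degree_le[OF g_dvd \<Delta>] by simp
  then obtain \<gamma> where \<gamma>: "g = [:\<gamma>:]" by (elim degree_eq_zeroE)
  have coeff_g: "Polynomial.coeff (p * g) k = Polynomial.coeff p k * \<gamma>" for p k
    by (simp add: \<gamma>)
  have coeffs: "Polynomial.coeff q0 1 = Polynomial.coeff C 0" "Polynomial.coeff q0 0 = Polynomial.coeff (D * x) 0"
    "Polynomial.coeff f0 1 = Polynomial.coeff (x * A) 0" "Polynomial.coeff f0 0 = Polynomial.coeff (x * B * x) 0"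
    unfolding q0_def f0_def using deg deg' by (simp_all only: coeff_linear_X3)
  \<comment> \<open>The determinants formed from \<open>f0, q0\<close> and from \<open>f, q\<close>
    differ by the factor \<open>\<gamma> ^ 2\<close>, so the latter is nonzero as well.\<close>
  have "Polynomial.coeff f0 1 * Polynomial.coeff q0 0 - Polynomial.coeff f0 0 * Polynomial.coeff q0 1 =
      Polynomial.coeff (x ^ 2 * (A * D - B * C)) 0"
    unfolding coeffs by (simp add: coeff_mult_0 power2_eq_square algebra_simps)
  also have "\<dots> \<noteq> 0"
    using \<Delta> deg_\<Delta> by (metis leading_coeff_0_iff)
  finally have dets: "Polynomial.coeff f 1 * Polynomial.coeff q 0 \<noteq> Polynomial.coeff f 0 * Polynomial.coeff q 1"
    unfolding qf coeff_g by (auto simp: algebra_simps)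
  have "Polynomial.degree q0 \<le> 1" "Polynomial.degree f0 \<le> 1"
    unfolding q0_def f0_def using deg deg' coeff_linear_X3(3) by blast+
  then have degs: "Polynomial.degree q \<le> 1" "Polynomial.degree f \<le> 1"
    using degree_mult_eq[of q g] degree_mult_eq[of f g] \<open>q0 \<noteq> 0\<close> \<open>f0 \<noteq> 0\<close>
    by (auto simp: qf)
  have "is_form (n + 1) q0"
    unfolding q0_def using forms x(3) by (intro is_form_add is_form_mult) auto
  have "is_form (1 + n + 1) f0"
    unfolding f0_def using forms x(3) by (intro is_form_add is_form_mult) auto
  obtain m1 where m1: "m1 \<le> n + 1" "is_form m1 q" "is_form (n + 1 - m1) g"
    using form_factor[of "n + 1" q g] \<open>is_form (n + 1) q0\<close> \<open>q0 \<noteq> 0\<close> unfolding qf by blast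
  obtain m2 where m2: "m2 \<le> 1 + n + 1" "is_form m2 f" "is_form (1 + n + 1 - m2) g"
    using form_factor[of "1 + n + 1" f g] \<open>is_form (1 + n + 1) f0\<close> \<open>f0 \<noteq> 0\<close> unfolding qf by blast
  \<comment> \<open>Both factorisations give the degree of the same \<open>g\<close>, so the excess
    of one degree carries over from \<open>f0\<close> against \<open>q0\<close> to \<open>f\<close>
    against \<open>q\<close>.\<close>
  have "n + 1 - m1 = 1 + n + 1 - m2"
    using form_degree_unique[OF m1(3) m2(3) \<open>g \<noteq> 0\<close>] .
  with m1(1) m2(1) have "m2 = m1 + 1" by linarith
  have "X $ 1 * (A * X $ 3 + B * X $ 1) = f0"
    by (simp add: f0_def x_def algebra_simps)
  then have "X $ 1 * (A * X $ 3 + B * X $ 1) = f * g" using qf(2) by simp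
  moreover have "C * X $ 3 + D * X $ 1 = q * g" using qf(1) by (simp only: q0_def x_def)
  moreover have "is_form (m1 + 1) f" using m2(2) \<open>m2 = m1 + 1\<close> by simp
  ultimately show ?thesis
    using that g_dvd[unfolded x_def] qf(3) m1(2) degs dets by blast
qed

section \<open>The pencil of lines through a point\<close>

text \<open>
  \<open>M\<close> is the change to coordinates in which the centre, the last column of \<open>N\<close>, is \<open>(0 : 0 : 1)\<close>;
  binary forms in the new coordinates are the forms on the pencil of lines through the centre.
\<close>

locale plane_curve_center = plane_curve +
  fixes M N :: "complex ^ 3 ^ 3"
  assumes MN: "M ** N = mat 1" and degree_ge_2: "d \<ge> 2"
begin

definition T :: "mpoly \<Rightarrow> mpoly" where
  "T = subst (linear_map M)"

sublocale T: mpoly_hom T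
  unfolding T_def by unfold_locales (simp_all add: subst_simps)

lemmas T_simps = T.zero T.one T.add T.mult T.diff T.uminus T.power

lemma T_const [simp]: "T (const c) = const c"
  by (simp add: T_def)

lemma T_form: "is_form n G \<Longrightarrow> is_form n (T G)"
  unfolding T_def by (rule is_form_subst_linear_map)

lemma T_X: "T (X $ i) = linear_form (M $ i)"
  by (simp add: T_def linear_map_def)

lemma T_eq_0: "T G = 0 \<Longrightarrow> G = 0"
  unfolding T_def using MN by (rule subst_linear_map_inj)

lemma T_inv: "T (subst (linear_map N) G) = G"
proof -
  have "N ** M = mat 1" using MN by (simp add: matrix_left_right_inverse)
  then show ?thesis by (simp add: T_def subst_subst map_comp_linear_maps)
qed

text \<open>A curve of degree at least 2 is not a line, so the new coordinates may serve as
  denominators.\<close>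

lemma F_not_dvd_T_X: "\<not> F dvd T (X $ i)"
proof
  assume "F dvd T (X $ i)"
  moreover have "T (X $ i) \<noteq> 0" using T_eq_0 by fastforce
  ultimately have "d \<le> 1"
    using form_dvd_degree_le[OF F_form T_form[OF is_form_X]] by blast
  with degree_ge_2 show False by simp
qed

text \<open>Coprimality is given in the centred coordinates, so \<open>F\<close> is carried there by
  \<open>N\<close>; it would become a unit, and then \<open>F\<close> would be one.\<close>

lemma coprime_not_both_vanish:
  assumes "coprime q f" "F dvd T q" "F dvd T f"
  shows False
proof -
  define F' where "F' = subst (linear_map N) F"
  have dvd: "F' dvd G" if "F dvd T G" for G
  proof -
    from that obtain H where "T G = F * H" by (elim dvdE)
    then have "subst (linear_map N) (T G) = F' * subst (linear_map N) H"
      by (simp add: F'_def subst_simps)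
    then show ?thesis
      using MN by (simp add: T_def subst_subst map_comp_linear_maps)
  qed
  have "F' dvd 1" using assms dvd coprime_common_divisor by blast
  then obtain H where "1 = F' * H" by (elim dvdE)
  then have "1 = F * T H"
    using T_inv[of F] by (metis F'_def T.mult T.one)
  then show False using F_not_dvd_1 by (metis dvd_triv_left)
qed

text \<open>The coordinate \<open>y\<close> of the overview: on a general line through
  \<open>(0 : 0 : 1)\<close> it is affine, with the centre at infinity.\<close>

definition slope :: "mpoly fract" where
  "slope = Fract (T (X $ 3)) (T (X $ 1))"

text \<open>Representatives of the elements of \<open>K\<^sub>P\<close>, once the last column of
  \<open>N\<close> is the centre (\<open>pullback_field_eq\<close>).\<close>

definition binary_fraction :: "mpoly fract \<Rightarrow> bool" where
  "binary_fraction u \<longleftrightarrow>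
     (\<exists>n A B. binary_form n A \<and> binary_form n B \<and> \<not> F dvd T B \<and> u = Fract (T A) (T B))"

lemma binary_fractionI:
  "binary_form n A \<Longrightarrow> binary_form n B \<Longrightarrow> \<not> F dvd T B \<Longrightarrow> binary_fraction (Fract (T A) (T B))"
  by (auto simp: binary_fraction_def)

lemma binary_fraction_in_LR: "binary_fraction u \<Longrightarrow> u \<in> LR"
  by (auto simp: binary_fraction_def binary_form_def intro!: Fract_in_LR T_form)

lemma slope_in_LR: "slope \<in> LR"
  unfolding slope_def by (intro Fract_in_LR[of 1] T_form is_form_X F_not_dvd_T_X)

lemma binary_fraction_common_denominator:
  assumes "binary_fraction u" "binary_fraction v" "binary_fraction w" "binary_fraction z"
  obtains n A B C D E where "binary_form n A" "binary_form n B" "binary_form n C" "binary_form n D"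
    "binary_form n E" "\<not> F dvd T E" "u = Fract (T A) (T E)" "v = Fract (T B) (T E)"
    "w = Fract (T C) (T E)" "z = Fract (T D) (T E)"
proof -
  obtain n1 A1 B1 where 1: "binary_form n1 A1" "binary_form n1 B1" "\<not> F dvd T B1" "u = Fract (T A1) (T B1)"
    using assms(1) by (auto simp: binary_fraction_def)
  obtain n2 A2 B2 where 2: "binary_form n2 A2" "binary_form n2 B2" "\<not> F dvd T B2" "v = Fract (T A2) (T B2)"
    using assms(2) by (auto simp: binary_fraction_def)
  obtain n3 A3 B3 where 3: "binary_form n3 A3" "binary_form n3 B3" "\<not> F dvd T B3" "w = Fract (T A3) (T B3)"
    using assms(3) by (auto simp: binary_fraction_def)
  obtain n4 A4 B4 where 4: "binary_form n4 A4" "binary_form n4 B4" "\<not> F dvd T B4" "z = Fract (T A4) (T B4)"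
    using assms(4) by (auto simp: binary_fraction_def)
  have nz: "T B1 \<noteq> 0" "T B2 \<noteq> 0" "T B3 \<noteq> 0" "T B4 \<noteq> 0" using 1 2 3 4 by auto
  show ?thesis
  proof
    show "binary_form (n1 + n2 + n3 + n4) (A1 * B2 * B3 * B4)"
      "binary_form (n1 + n2 + n3 + n4) (B1 * A2 * B3 * B4)"
      "binary_form (n1 + n2 + n3 + n4) (B1 * B2 * A3 * B4)"
      "binary_form (n1 + n2 + n3 + n4) (B1 * B2 * B3 * A4)"
      "binary_form (n1 + n2 + n3 + n4) (B1 * B2 * B3 * B4)"
      by (intro binary_form_mult 1 2 3 4)+
    show "\<not> F dvd T (B1 * B2 * B3 * B4)"
      using 1 2 3 4 by (simp add: T_simps F_dvd_mult_iff)
  qed (use nz 1 2 3 4 in \<open>simp_all add: T_simps eq_fract mult_ac\<close>)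
qed

end

locale plane_curve_center_endo =
  plane_curve_center F d M N + plane_curve_endo F d \<sigma> for F d M N \<sigma> +
  assumes lifts_binary: "binary_fraction u \<Longrightarrow> lifts u u"
begin

text \<open>Divided by \<open>T (X $ 1)\<close>, the centred coordinates are 1, a binary fraction
  fixed by \<open>\<sigma>\<close>, and \<open>slope\<close>, whose image is prescribed. The
  original coordinates are constant combinations of these through \<open>N\<close>.\<close>

lemma jonquieres_induces:
  assumes q: "is_form m q" "\<not> F dvd T q" and f: "is_form (m + 1) f"
    and slope: "lifts slope (Fract (T f) (T q * T (X $ 1)))"
  shows "induces F (conjugate_by N M (jonquieres q f)) \<sigma>"
proof (rule inducesI)
  define \<Phi> where "\<Phi> = conjugate_by N M (jonquieres q f)"
  have NM: "N ** M = mat 1" using MN by (simp add: matrix_left_right_inverse)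
  have "is_form (m + 1) (jonquieres q f $ i)" for i
    using exhaust_3[of i] is_form_mult[OF q(1) is_form_X] f by auto
  then show "is_form (m + 1) (conjugate_by N M (jonquieres q f) $ i)" for i
    by (rule is_form_conjugate)
  show "T (X $ 1) = linear_form (M $ 1)" by (rule T_X)
  show F1: "\<not> F dvd T (X $ 1)" by (rule F_not_dvd_T_X)
  have \<Phi>: "\<Phi> $ i = (\<Sum>j\<in>UNIV. const (N $ i $ j) * T (jonquieres q f $ j))" for i
    by (simp add: \<Phi>_def conjugate_by_def map_comp_linear_map T_def) (simp add: map_comp_def)
  have X: "X $ i = (\<Sum>j\<in>UNIV. const (N $ i $ j) * T (X $ j))" for i
  proof -
    have "X $ i = map_comp (linear_map N) (linear_map M) $ i"
      by (simp add: map_comp_linear_maps NM)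
    then show ?thesis by (simp add: map_comp_linear_map T_def)
  qed
  have "map_comp (linear_map M) \<Phi> =
      map_comp (map_comp (linear_map M) (linear_map N)) (map_comp (jonquieres q f) (linear_map M))"
    by (simp add: \<Phi>_def conjugate_by_def map_comp_assoc)
  also have "\<dots> $ 1 = T (q * X $ 1)"
    unfolding map_comp_linear_maps MN linear_map_1 by (simp add: map_comp_def T_def)
  finally have "map_comp (linear_map M) \<Phi> $ 1 = T (q * X $ 1)" .
  then have l: "subst \<Phi> (T (X $ 1)) = T q * T (X $ 1)"
    by (simp add: map_comp_def T_X T.mult) (simp add: linear_map_def)
  have "\<not> F dvd T q * T (X $ 1)" using F1 q(2) by (simp add: F_dvd_mult_iff)
  then show "\<not> F dvd subst (conjugate_by N M (jonquieres q f)) (T (X $ 1))"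
    using l by (simp add: \<Phi>_def)
  have nz: "T (X $ 1) \<noteq> 0" "T q * T (X $ 1) \<noteq> 0"
    using F1 \<open>\<not> F dvd T q * T (X $ 1)\<close> by auto
  have lin: "Fract (const a1 * G1 + const a2 * G2 + const a3 * G3) h =
      Fract (const a1) 1 * Fract G1 h + Fract (const a2) 1 * Fract G2 h + Fract (const a3) 1 * Fract G3 h"
    for a1 a2 a3 and G1 G2 G3 h :: mpoly
    by (simp add: Fract_conv_to_fract add_divide_distrib)
  have "lifts (Fract (T (X $ j)) (T (X $ 1))) (Fract (T (jonquieres q f $ j)) (T q * T (X $ 1)))" for j
  proof -
    have "Fract (T (jonquieres q f $ 1)) (T q * T (X $ 1)) = Fract (T (X $ 1)) (T (X $ 1))"
      "Fract (T (jonquieres q f $ 2)) (T q * T (X $ 1)) = Fract (T (X $ 2)) (T (X $ 1))"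
      using nz by (simp_all add: T_simps eq_fract mult_ac)
    moreover have "lifts (Fract (T (X $ k)) (T (X $ 1))) (Fract (T (X $ k)) (T (X $ 1)))"
      if "k = 1 \<or> k = 2" for k
      using that binary_form_X by (intro lifts_binary binary_fractionI[of 1] F1) auto
    ultimately show ?thesis
      using exhaust_3[of j] slope by (auto simp: slope_def)
  qed
  then have "lifts (Fract (X $ i) (T (X $ 1))) (Fract (\<Phi> $ i) (T q * T (X $ 1)))" for i
    unfolding X[of i] \<Phi> sum_3 lin by (intro lifts_add lifts_mult lifts_const)
  then show "lifts (Fract (X $ i) (T (X $ 1)))
      (Fract (conjugate_by N M (jonquieres q f) $ i) (subst (conjugate_by N M (jonquieres q f)) (T (X $ 1))))" for i
    using l by (simp add: \<Phi>_def)
qed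

text \<open>The passage from the curve to the plane: \<open>rel\<close> is the Moebius formula for
  the image of \<open>slope\<close>, freed of its denominator. The reduced coefficients give a
  fraction that may differ from \<open>y\<close> but agrees with it modulo \<open>I\<close>, which
  is enough for \<open>lifts\<close>.\<close>

theorem moebius_extends:
  assumes bin: "binary_fraction a" "binary_fraction b" "binary_fraction c" "binary_fraction e"
    and det: "a * e - b * c \<notin> I"
    and y: "lifts slope y"
    and rel: "c * slope * y + e * y - a * slope - b \<in> I"
  obtains \<Phi> where "de_jonquieres \<Phi>" "induces F \<Phi> \<sigma>"
proof -
  obtain n A B C D E where forms: "binary_form n A" "binary_form n B" "binary_form n C"
    "binary_form n D" "binary_form n E" and E: "\<not> F dvd T E"
    and abce: "a = Fract (T A) (T E)" "b = Fract (T B) (T E)" "c = Fract (T C) (T E)" "e = Fract (T D) (T E)"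
    using binary_fraction_common_denominator[OF bin] by metis
  have Tforms: "is_form n (T A)" "is_form n (T B)" "is_form n (T C)" "is_form n (T D)" "is_form n (T E)"
    using forms by (auto simp: binary_form_def intro: T_form)
  obtain G H k where y_eq: "y = Fract G H" and GH: "is_form k G" "is_form k H" "\<not> F dvd H" "H \<noteq> 0"
    using y by (auto simp: lifts_def elim: LR_E)
  define l r where "l = T (X $ 1)" and "r = T (X $ 3)"
  have lr: "is_form 1 l" "is_form 1 r" "\<not> F dvd l"
    by (simp_all only: l_def r_def T_form is_form_X F_not_dvd_T_X not_False_eq_True)
  have nz: "T E \<noteq> 0" "l \<noteq> 0" using E lr by auto
  have "a * e - b * c = Fract (T (A * D - B * C)) (T E * T E)"
    using nz by (simp add: abce T_simps Fract_conv_to_fract field_simps)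
  then have \<Delta>: "\<not> F dvd T (A * D - B * C)"
    using det by (auto simp: vanishing_ideal_def)
      (metis E F_dvd_mult_iff T_simps Tforms is_form_diff is_form_mult)
  then have "A * D - B * C \<noteq> 0" using T.zero by auto
  from moebius_reduction[OF forms(1-4) this] obtain g q f m
    where g: "C * X $ 3 + D * X $ 1 = q * g" "X $ 1 * (A * X $ 3 + B * X $ 1) = f * g"
      "g dvd X $ 1 ^ 2 * (A * D - B * C)"
      and qf: "coprime q f" "is_form m q" "is_form (m + 1) f"
      "Polynomial.degree q \<le> 1" "Polynomial.degree f \<le> 1"
      "Polynomial.coeff f 1 * Polynomial.coeff q 0 \<noteq> Polynomial.coeff f 0 * Polynomial.coeff q 1" .
  \<comment> \<open>Cancelling \<open>g\<close> must not cancel the equation of the curve: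
    \<open>g\<close> divides a product whose factors do not vanish there.\<close>
  have "\<not> F dvd T g"
  proof
    assume "F dvd T g"
    moreover have "T g dvd T (X $ 1 ^ 2 * (A * D - B * C))"
      using g(3) by (elim dvdE) (metis T.mult dvd_triv_left)
    ultimately have "F dvd l ^ 2 * T (A * D - B * C)"
      by (metis dvd_trans T.mult T.power l_def)
    with \<Delta> lr(3) F_dvd_power show False by (auto simp: F_dvd_mult_iff)
  qed
  \<comment> \<open>The numerator of \<open>rel\<close> over the common denominator
    \<open>T E * l * H\<close>.\<close>
  define R where "R = (T C * r + T D * l) * G - (T A * r + T B * l) * H"
  have "is_form (n + 1 + k) R" "is_form (n + 1 + k) (T E * l * H)"
    unfolding R_def by (intro is_form_diff is_form_add is_form_mult Tforms lr GH)+
  moreover have "\<not> F dvd T E * l * H"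
    using E lr GH by (simp add: F_dvd_mult_iff)
  moreover have "c * slope * y + e * y - a * slope - b = Fract R (T E * l * H)"
    using nz GH(4)
    by (simp add: abce y_eq slope_def l_def[symmetric] r_def[symmetric] R_def Fract_conv_to_fract field_simps)
  ultimately have "F dvd R" using rel I_iff by simp
  \<comment> \<open>The factor \<open>l\<close> matches the extra \<open>X $ 1\<close> in
    \<open>f * g\<close>, so that \<open>T g\<close> can be pulled out and cancelled.\<close>
  then have "F dvd l * R" by simp
  also have "l * R = T (C * X $ 3 + D * X $ 1) * l * G - T (X $ 1 * (A * X $ 3 + B * X $ 1)) * H"
    by (simp add: R_def T.mult T.add l_def r_def algebra_simps)
  also have "\<dots> = T g * (T q * l * G - T f * H)"
    unfolding g(1,2) by (simp add: T.mult algebra_simps)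
  finally have rel': "F dvd T q * l * G - T f * H"
    using \<open>\<not> F dvd T g\<close> by (simp add: F_dvd_mult_iff)
  \<comment> \<open>If \<open>q\<close> vanished on the curve, \<open>rel'\<close> would force
    \<open>f\<close> to vanish there too, against coprimality.\<close>
  have q: "\<not> F dvd T q"
  proof
    assume *: "F dvd T q"
    then have "F dvd T q * l * G" by simp
    with rel' have "F dvd T f * H" by (metis dvd_diff_right_iff)
    then have "F dvd T f" using GH(3) by (simp add: F_dvd_mult_iff)
    with * qf(1) show False using coprime_not_both_vanish by blast
  qed
  define z where "z = Fract (T f) (T q * T (X $ 1))"
  have zforms: "is_form (m + 1) (T f)" "is_form (m + 1) (T q * l)"
    by (intro is_form_mult T_form qf lr)+
  have "\<not> F dvd T q * l" using q lr by (simp add: F_dvd_mult_iff)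
  note zforms = zforms this
  have z: "z \<in> LR"
    unfolding z_def l_def[symmetric] using zforms by (intro Fract_in_LR)
  have "y - z = Fract (T q * l * G - T f * H) (H * (T q * l))"
  proof -
    have "T q \<noteq> 0" using q by auto
    with nz GH(4) show ?thesis
      by (simp add: y_eq z_def l_def[symmetric] Fract_conv_to_fract field_simps)
  qed
  moreover have "is_form (m + 1 + k) (T q * l * G - T f * H)" "is_form (m + 1 + k) (T q * l * H)"
    by (intro is_form_diff is_form_mult zforms(1,2) GH)+
  moreover have "\<not> F dvd T q * l * H" using zforms GH by (simp add: F_dvd_mult_iff)
  ultimately have "y - z \<in> I"
    using rel' I_iff by (metis mult.commute)
  then have "lifts slope z"
    using lifts_cong[OF y, of slope z] y z I_0 by (simp add: lifts_def)
  then have "induces F (conjugate_by N M (jonquieres q f)) \<sigma>"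
    using qf(2,3) q unfolding z_def by (intro jonquieres_induces)
  moreover have "de_jonquieres (conjugate_by N M (jonquieres q f))"
    using qf MN by (intro de_jonquieres_conjugate)
  ultimately show ?thesis using that by blast
qed

end

section \<open>Galois points\<close>

text \<open>\<open>P\<close> is completed to a basis by two standard basis vectors, leaving out one
  at which \<open>P\<close> has a nonzero coordinate.\<close>

lemma exists_matrix_with_center:
  assumes "P \<noteq> (0 :: complex ^ 3)"
  obtains M N :: "complex ^ 3 ^ 3" where "M ** N = mat 1" "\<And>i. N $ i $ 3 = P $ i"
proof -
  from assms have "P $ 1 \<noteq> 0 \<or> P $ 2 \<noteq> 0 \<or> P $ 3 \<noteq> 0"
    by (simp add: vec_eq_iff forall_3)
  then obtain N :: "complex ^ 3 ^ 3" where "det N \<noteq> 0" "\<forall>i. N $ i $ 3 = P $ i"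
  proof (elim disjE)
    assume "P $ 1 \<noteq> 0"
    then show ?thesis
      by (intro that[of "vector [vector [0, 0, P $ 1], vector [1, 0, P $ 2], vector [0, 1, P $ 3]]"])
         (auto simp: det_3 forall_3)
  next
    assume "P $ 2 \<noteq> 0"
    then show ?thesis
      by (intro that[of "vector [vector [1, 0, P $ 1], vector [0, 0, P $ 2], vector [0, 1, P $ 3]]"])
         (auto simp: det_3 forall_3)
  next
    assume "P $ 3 \<noteq> 0"
    then show ?thesis
      by (intro that[of "vector [vector [1, 0, P $ 1], vector [0, 1, P $ 2], vector [0, 0, P $ 3]]"])
         (auto simp: det_3 forall_3)
  qed
  then show ?thesis
    using that by (metis invertible_det_nz invertible_def)
qed

context plane_curve_center
begin

lemma linear_form_eq_T:
  "linear_form u = T (linear_form (u v* N))"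
proof -
  have X: "X $ i = T (\<Sum>j\<in>UNIV. const (N $ i $ j) * X $ j)" for i
    using T_inv[of "X $ i"] by (simp add: linear_map_def linear_form_def)
  have "linear_form u = (\<Sum>i\<in>UNIV. const (u $ i) * T (\<Sum>j\<in>UNIV. const (N $ i $ j) * X $ j))"
    unfolding linear_form_def by (subst X) simp
  also have "\<dots> = T (\<Sum>i\<in>UNIV. \<Sum>j\<in>UNIV. const (u $ i) * (const (N $ i $ j) * X $ j))"
    by (simp add: T.sum T.mult sum_distrib_left)
  also have "(\<Sum>i\<in>UNIV. \<Sum>j\<in>UNIV. const (u $ i) * (const (N $ i $ j) * X $ j)) =
      linear_form (u v* N)"
    by (simp add: linear_form_def vector_matrix_mult_def sum_3 algebra_simps)
  finally show ?thesis .
qed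

text \<open>In the new coordinates the coefficient of \<open>X $ 3\<close> in a linear form is its
  value at \<open>P\<close>, the last column of \<open>N\<close>.\<close>

lemma projection_from_T:
  assumes N: "\<And>i. N $ i $ 3 = P $ i" and "projection_from P l m"
  obtains u v where "linear_form l = T u" "linear_form m = T v"
    "binary_form 1 u" "binary_form 1 v"
proof -
  have *: "binary_form 1 (linear_form (w v* N))" if "(\<Sum>i\<in>UNIV. w $ i * P $ i) = 0" for w
  proof -
    have "(w v* N) $ 3 = 0"
      using that by (simp add: vector_matrix_mult_def N mult.commute)
    then have "linear_form (w v* N) =
        const ((w v* N) $ 1) * X $ 1 + const ((w v* N) $ 2) * X $ 2"
      by (simp add: linear_form_def sum_3)
    also have "Polynomial.degree \<dots> = 0"
      using degree_add_le_max[of "const ((w v* N) $ 1) * X $ 1" "const ((w v* N) $ 2) * X $ 2"]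
      by (simp add: degree_mult_0)
    finally show ?thesis
      using is_form_linear_form by (simp add: binary_form_def)
  qed
  show ?thesis
    using that[OF linear_form_eq_T linear_form_eq_T] * assms(2) by (simp add: projection_from_def)
qed

lemma projection_from_rows:
  assumes N: "\<And>i. N $ i $ 3 = P $ i"
  shows "projection_from P (M $ 1) (M $ 2)"
proof -
  have MN': "(\<Sum>k\<in>UNIV. M $ i $ k * N $ k $ j) = (if i = j then 1 else 0)" for i j
    using MN by (simp add: vec_eq_iff matrix_matrix_mult_def mat_def)
  have "a = 0 \<and> b = 0" if "a *s M $ 1 + b *s M $ 2 = 0" for a b
  proof -
    have eq: "a * M $ 1 $ k + b * M $ 2 $ k = 0" for k
      using that by (simp add: vec_eq_iff)
    have "a * (\<Sum>k\<in>UNIV. M $ 1 $ k * N $ k $ j) + b * (\<Sum>k\<in>UNIV. M $ 2 $ k * N $ k $ j) =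
        (\<Sum>k\<in>UNIV. (a * M $ 1 $ k + b * M $ 2 $ k) * N $ k $ j)" for j
      by (simp add: sum_3 algebra_simps)
    then have "a * (if 1 = j then 1 else 0) + b * (if 2 = j then 1 else 0) = 0" for j :: 3
      by (simp only: MN' eq) simp
    from this[of 1] this[of 2] show ?thesis by simp
  qed
  with MN'[of 1 3] MN'[of 2 3] show ?thesis
    by (simp add: projection_from_def N)
qed

lemma subst_T: "\<Phi> = map_comp \<Theta> (linear_map M) \<Longrightarrow> subst \<Phi> A = T (subst \<Theta> A)"
  by (simp add: T_def subst_subst)

text \<open>Any projection from \<open>P\<close> has binary components in the new coordinates, and
  substituting these keeps forms binary. Conversely, the first two rows of \<open>M\<close> are such
  a projection.\<close>

lemma pullback_field_eq:
  assumes N: "\<And>i. N $ i $ 3 = P $ i"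
  shows "pullback_field F P = res ` {u. binary_fraction u}"
proof (intro equalityI subsetI)
  fix x assume "x \<in> pullback_field F P"
  then obtain l m A B n where lm: "projection_from P l m" and AB: "binary_form n A" "binary_form n B"
    and B: "\<not> F dvd subst (vector [linear_form l, linear_form m, 0]) B"
    and x: "x = rat_fun F (subst (vector [linear_form l, linear_form m, 0]) A)
                (subst (vector [linear_form l, linear_form m, 0]) B)"
    by (auto simp: pullback_field_def)
  from projection_from_T[OF N lm] obtain u v where uv: "linear_form l = T u" "linear_form m = T v"
    "binary_form 1 u" "binary_form 1 v" .
  define \<Theta> where "\<Theta> = (vector [u, v, 0] :: mpoly ^ 3)"
  have "vector [linear_form l, linear_form m, 0] = map_comp \<Theta> (linear_map M)"
    by (simp add: vec_eq_iff forall_3 map_comp_def \<Theta>_def uv subst_simps T_def)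
  note T\<Theta> = subst_T[OF this]
  have "binary_form n (subst \<Theta> G)" if "binary_form n G" for G
  proof -
    have "is_form 1 (\<Theta> $ i)" "Polynomial.degree (\<Theta> $ i) = 0" for i
      using exhaust_3[of i] uv(3,4) by (auto simp: \<Theta>_def binary_form_def)
    with is_form_subst[of n G 1 \<Theta>] degree_subst_0[of \<Theta> G] that show ?thesis
      by (simp add: binary_form_def)
  qed
  then have "binary_fraction (Fract (T (subst \<Theta> A)) (T (subst \<Theta> B)))"
    using AB B by (intro binary_fractionI) (auto simp: T\<Theta>)
  then show "x \<in> res ` {u. binary_fraction u}"
    unfolding x T\<Theta> rat_fun_res by blast
next
  fix x assume "x \<in> res ` {u. binary_fraction u}"
  then obtain A B n where AB: "binary_form n A" "binary_form n B" "\<not> F dvd T B"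
    and x: "x = rat_fun F (T A) (T B)"
    by (auto simp: binary_fraction_def rat_fun_res)
  have T_eq: "T G = subst (vector [linear_form (M $ 1), linear_form (M $ 2), 0]) G"
    if "binary_form n G" for G
    unfolding T_def using that
    by (intro degree_0_subst_cong) (simp_all add: linear_map_def binary_form_def)
  show "x \<in> pullback_field F P"
    unfolding pullback_field_def mem_Collect_eq
    using AB x projection_from_rows[OF N] T_eq[OF AB(1)] T_eq[OF AB(2)]
    by (intro exI[of _ "M $ 1"] exI[of _ "M $ 2"] exI[of _ A] exI[of _ B] exI[of _ n]) simp
qed

end

section \<open>Automorphism groups of order three\<close>

lemma gal_group_simps:
  "\<sigma> \<in> carrier (gal_group L K) \<longleftrightarrow>
     \<sigma> \<in> ring_hom L L \<and> \<sigma> \<in> Bij (carrier L) \<and> (\<forall>x\<in>K. \<sigma> x = x)"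
  "\<sigma> \<in> Bij (carrier L) \<Longrightarrow> \<tau> \<in> Bij (carrier L) \<Longrightarrow>
     \<sigma> \<otimes>\<^bsub>gal_group L K\<^esub> \<tau> = compose (carrier L) \<sigma> \<tau>"
  by (auto simp: gal_group_def BijGroup_def)

lemma gal_group_mult_closed:
  assumes "K \<subseteq> carrier L" and "\<sigma> \<in> carrier (gal_group L K)" "\<tau> \<in> carrier (gal_group L K)" "ring L"
  shows "compose (carrier L) \<sigma> \<tau> \<in> carrier (gal_group L K)"
proof -
  interpret ring L by fact
  have \<sigma>: "\<sigma> \<in> ring_hom L L" "\<sigma> \<in> Bij (carrier L)" and \<tau>: "\<tau> \<in> ring_hom L L" "\<tau> \<in> Bij (carrier L)"
    using assms by (auto simp: gal_group_simps)
  have "compose (carrier L) \<sigma> \<tau> \<in> ring_hom L L"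
    using \<sigma>(1) \<tau>(1)
    by (intro ring_hom_memI) (auto simp: compose_def ring_hom_closed ring_hom_mult ring_hom_add ring_hom_one)
  then show ?thesis
    using assms \<sigma>(2) \<tau>(2) by (auto simp: gal_group_simps compose_Bij) (auto simp: compose_def subset_iff)
qed

lemma gal_group_one_closed:
  assumes "K \<subseteq> carrier L" "ring L"
  shows "(\<lambda>x\<in>carrier L. x) \<in> carrier (gal_group L K)"
proof -
  interpret ring L by fact
  have "(\<lambda>x\<in>carrier L. x) \<in> ring_hom L L" by (intro ring_hom_memI) auto
  then show ?thesis using assms by (auto simp: gal_group_simps id_Bij)
qed

text \<open>In a group of order three all cubes are trivial and a nontrivial element generates. The
  witness \<open>y\<close> expresses that \<open>\<sigma>\<close> is not the identity.\<close>

lemma gal_group_Z3: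
  assumes L: "ring L" "K \<subseteq> carrier L" and iso: "gal_group L K \<cong> integer_mod_group 3"
    and \<sigma>: "\<sigma> \<in> carrier (gal_group L K)"
  shows "x \<in> carrier L \<Longrightarrow> \<sigma> (\<sigma> (\<sigma> x)) = x"
    and "x \<in> carrier L \<Longrightarrow> \<sigma> x = x \<Longrightarrow> y \<in> carrier L \<Longrightarrow> \<sigma> y \<noteq> y \<Longrightarrow>
      \<tau> \<in> carrier (gal_group L K) \<Longrightarrow> \<tau> x = x"
proof -
  let ?G = "carrier (gal_group L K)" and ?o = "compose (carrier L)"
  define e where "e = (\<lambda>x\<in>carrier L. x)"
  from iso obtain h where h: "h \<in> hom (gal_group L K) (integer_mod_group 3)"
    and bij: "bij_betw h ?G (carrier (integer_mod_group 3))"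
    by (auto simp: is_iso_def iso_def)
  have closed: "?o \<alpha> \<beta> \<in> ?G" if "\<alpha> \<in> ?G" "\<beta> \<in> ?G" for \<alpha> \<beta>
    using gal_group_mult_closed[OF L(2) that L(1)] .
  have h_mult: "h (?o \<alpha> \<beta>) = (h \<alpha> + h \<beta>) mod 3" if "\<alpha> \<in> ?G" "\<beta> \<in> ?G" for \<alpha> \<beta>
  proof -
    have "\<alpha> \<otimes>\<^bsub>gal_group L K\<^esub> \<beta> = ?o \<alpha> \<beta>" using that by (simp add: gal_group_simps)
    with hom_mult[OF h that] show ?thesis by (simp add: integer_mod_group_def)
  qed
  have h_range: "h \<alpha> \<in> {0, 1, 2}" if "\<alpha> \<in> ?G" for \<alpha>
  proof -
    have "h \<alpha> \<in> {0..<3}"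
      using bij_betw_apply[OF bij that] by (simp add: carrier_integer_mod_group)
    then show ?thesis by auto
  qed
  have inj: "\<alpha> = \<beta>" if "h \<alpha> = h \<beta>" "\<alpha> \<in> ?G" "\<beta> \<in> ?G" for \<alpha> \<beta>
    using bij that by (auto simp: bij_betw_def inj_on_def)
  have e: "e \<in> ?G" unfolding e_def by (rule gal_group_one_closed[OF L(2,1)])
  have "?o e e = e" by (auto simp: compose_def e_def)
  with h_mult[OF e e] h_range[OF e] have he: "h e = 0" by auto
  have map: "\<alpha> x \<in> carrier L" if "\<alpha> \<in> ?G" "x \<in> carrier L" for \<alpha> x
    using that by (auto simp: gal_group_simps intro: ring_hom_closed)
  show "\<sigma> (\<sigma> (\<sigma> x)) = x" if "x \<in> carrier L"
  proof -
    have "h (?o \<sigma> (?o \<sigma> \<sigma>)) = h e"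
      using h_range[OF \<sigma>] by (auto simp: he h_mult closed \<sigma>)
    then have "?o \<sigma> (?o \<sigma> \<sigma>) = e" using inj closed \<sigma> e by blast
    then have "?o \<sigma> (?o \<sigma> \<sigma>) x = e x" by simp
    then show ?thesis using that map[OF \<sigma>] by (simp add: compose_def e_def)
  qed
  show "\<tau> x = x" if x: "x \<in> carrier L" "\<sigma> x = x" and y: "y \<in> carrier L" "\<sigma> y \<noteq> y" and \<tau>: "\<tau> \<in> ?G"
  proof -
    have "\<sigma> \<noteq> e" using y by (auto simp: e_def)
    then have "h \<sigma> \<noteq> 0" using inj[OF _ \<sigma> e] he by auto
    \<comment> \<open>For \<open>h \<sigma>\<close> equal to 1 or 2, the residues of 0,
      \<open>h \<sigma>\<close> and \<open>2 * h \<sigma>\<close> are all residues modulo 3.\<close>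
    then have "h \<tau> = h e \<or> h \<tau> = h \<sigma> \<or> h \<tau> = h (?o \<sigma> \<sigma>)"
      using h_range[OF \<sigma>] h_range[OF \<tau>] by (auto simp: he h_mult \<sigma>)
    then have "\<tau> = e \<or> \<tau> = \<sigma> \<or> \<tau> = ?o \<sigma> \<sigma>" using inj closed \<sigma> \<tau> e by blast
    with x show ?thesis by (auto simp: e_def compose_def)
  qed
qed

text \<open>
  The relation \<open>c x y + e y - a x - b = 0\<close> and its two cyclic shifts form a linear system for
  \<open>(c, e, - a, - b)\<close>. The coefficients below are its \<open>3 \<times> 3\<close> minors, which are invariant under
  cyclic permutations of \<open>x, y, z\<close> because these are even.
\<close>

definition cyc_a :: "'a::comm_ring_1 \<Rightarrow> 'a \<Rightarrow> 'a \<Rightarrow> 'a" where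
  "cyc_a x y z = x * x * y + y * y * z + z * z * x - (x * y * z + x * y * z + x * y * z)"
definition cyc_b :: "'a::comm_ring_1 \<Rightarrow> 'a \<Rightarrow> 'a \<Rightarrow> 'a" where
  "cyc_b x y z = x * y * z * (x + y + z) - (x * x * y * y + y * y * z * z + z * z * x * x)"
definition cyc_c :: "'a::comm_ring_1 \<Rightarrow> 'a \<Rightarrow> 'a \<Rightarrow> 'a" where
  "cyc_c x y z = x * x + y * y + z * z - (x * y + y * z + z * x)"
definition cyc_e :: "'a::comm_ring_1 \<Rightarrow> 'a \<Rightarrow> 'a \<Rightarrow> 'a" where
  "cyc_e x y z = x * y * z + x * y * z + x * y * z - (x * y * y + y * z * z + z * x * x)"

lemmas cyc_defs = cyc_a_def cyc_b_def cyc_c_def cyc_e_def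

text \<open>Expansion of a 4 by 4 determinant in which the row of the pair \<open>x, y\<close>
  occurs twice.\<close>

lemma cyc_relation: "cyc_c x y z * x * y + cyc_e x y z * y - cyc_a x y z * x - cyc_b x y z = 0"
  unfolding cyc_defs by (simp add: algebra_simps)

text \<open>The square of the Vandermonde product, so the Moebius map is nondegenerate as soon as
  the three conjugates are distinct.\<close>

lemma cyc_det: "cyc_a x y z * cyc_e x y z - cyc_b x y z * cyc_c x y z =
    ((x - y) * (y - z) * (z - x)) * ((x - y) * (y - z) * (z - x))"
  unfolding cyc_defs by (simp add: algebra_simps)

lemma cyc_rotate: "cyc_a y z x = cyc_a x y z" "cyc_b y z x = cyc_b x y z"
  "cyc_c y z x = cyc_c x y z" "cyc_e y z x = cyc_e x y z"
  unfolding cyc_defs by (simp_all add: algebra_simps)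
context plane_curve
begin

lemma I_mult: "x \<in> I \<Longrightarrow> y \<in> LR \<Longrightarrow> x * y \<in> I" "x \<in> LR \<Longrightarrow> y \<in> I \<Longrightarrow> x * y \<in> I"
  by (simp_all add: I_mult_iff I_subset_LR)

lemma I_cong: "x - y \<in> I \<Longrightarrow> x \<in> I \<longleftrightarrow> y \<in> I"
  using I_add[of "x - y" y] I_diff[of x "x - y"] by auto

end

theorem theorem1:
  fixes F :: mpoly and d :: nat and P :: "complex ^ 3"
  assumes "d \<ge> 3"
    and "irreducible_plane_curve d F"
    and "galois_point F P"
    and "galois_group_at F P \<cong> integer_mod_group 3"
  shows "(\<forall>\<sigma> \<in> carrier (galois_group_at F P). \<exists>\<Phi>. de_jonquieres \<Phi> \<and> restricts_to F \<Phi> \<sigma>) \<and>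
         (\<forall>\<sigma> \<in> carrier (galois_group_at F P). \<exists>\<Phi>. cremona \<Phi> \<and> restricts_to F \<Phi> \<sigma>)"
proof -
  define L where "L = function_field F"
  define K where "K = pullback_field F P"
  have "P \<noteq> 0" and galois: "galois_extension L K"
    using assms(3) by (auto simp: galois_point_def L_def K_def)
  have iso: "gal_group L K \<cong> integer_mod_group 3"
    using assms(4) by (simp add: galois_group_at_def L_def K_def)
  obtain M N :: "complex ^ 3 ^ 3" where center: "M ** N = mat 1" "\<And>i. N $ i $ 3 = P $ i"
    using exists_matrix_with_center[OF \<open>P \<noteq> 0\<close>] by metis
  interpret plane_curve_center F d M N
    using assms(1,2) center(1) by unfold_locales auto
  have K: "K = res ` {u. binary_fraction u}"
    unfolding K_def using center(2) by (rule pullback_field_eq)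
  have carrier_L: "carrier L = res ` LR"
    by (simp add: L_def carrier_function_field)
  have "ring L"
    using galois field.is_ring by (auto simp: galois_extension_def)
  have "K \<subseteq> carrier L"
    using K carrier_L binary_fraction_in_LR by auto
  note Z3 = gal_group_Z3[OF \<open>ring L\<close> \<open>K \<subseteq> carrier L\<close> iso]
  have "\<exists>\<Phi>. de_jonquieres \<Phi> \<and> induces F \<Phi> \<sigma>" if \<sigma>: "\<sigma> \<in> carrier (gal_group L K)" for \<sigma>
  proof -
    have fix_K: "\<sigma> (res u) = res u" if "binary_fraction u" for u
      using \<sigma> that by (auto simp: gal_group_simps K)
    \<comment> \<open>Constants are quotients of binary forms of degree 0, so they lie in
      \<open>K\<close> and \<open>\<sigma>\<close> fixes them.\<close>
    have bin_const: "binary_fraction (Fract (const c) 1)" for c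
      using binary_fractionI[of 0 "const c" 1] F_not_dvd_1 binary_form_const[of 1]
      by (simp add: T.one)
    interpret plane_curve_center_endo F d M N \<sigma>
    proof unfold_locales
      show "\<sigma> \<in> ring_hom (function_field F) (function_field F)"
        using \<sigma> by (simp add: gal_group_simps L_def)
      show "inj_on \<sigma> (carrier (function_field F))"
        using \<sigma> by (auto simp: gal_group_simps L_def Bij_def bij_betw_def)
      show \<sigma>_const: "\<sigma> (res (Fract (const c) 1)) = res (Fract (const c) 1)" for c
        using fix_K bin_const by blast
      then interpret plane_curve_endo F d \<sigma>
        using \<open>\<sigma> \<in> ring_hom _ _\<close> \<open>inj_on \<sigma> _\<close> by unfold_locales
      show "plane_curve_endo.lifts F \<sigma> u u" if "binary_fraction u" for u
        using fix_K that binary_fraction_in_LR by (simp add: lifts_def)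
    qed
    have bin: "binary_fraction 0" "binary_fraction 1"
      using bin_const[of 0] bin_const[of 1] by (simp_all add: Zero_fract_def One_fract_def)
    define x where "x = slope"
    have x: "x \<in> LR" by (simp add: x_def slope_in_LR)
    obtain y where y: "lifts x y" using lifts_exists[OF x] .
    show ?thesis
    proof (cases "x - y \<in> I")
      \<comment> \<open>The three conjugates coincide and the minors degenerate; the identity matrix
        supplies the coefficients 1, 0, 0, 1.\<close>
      case True
      then have "0 * slope * y + 1 * y - 1 * slope - 0 \<in> I"
        using I_uminus[of "x - y"] by (simp add: x_def)
      moreover have "1 * 1 - 0 * 0 \<notin> I" using I_1 by simp
      ultimately obtain \<Phi> where "de_jonquieres \<Phi>" "induces F \<Phi> \<sigma>"
        using moebius_extends[OF bin(2,1,1,2)] y unfolding x_def by metis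
      then show ?thesis by blast
    next
      case False
      have "y \<in> LR" using y by (simp add: lifts_def)
      then obtain z where z: "lifts y z" using lifts_exists by blast
      then have "z \<in> LR" by (simp add: lifts_def)
      have "\<sigma> (\<sigma> (\<sigma> (res x))) = res x"
        using Z3(1)[OF \<sigma>] x carrier_L by simp
      then have zx: "lifts z x"
        using y z x \<open>z \<in> LR\<close> by (simp add: lifts_def)
      have moved: "res x \<in> carrier L" "\<sigma> (res x) \<noteq> res x"
        using False y x \<open>y \<in> LR\<close> res_eq_iff[of x y] by (auto simp: lifts_def carrier_L)
      \<comment> \<open>As \<open>\<sigma>\<close> moves \<open>res x\<close>, it generates the
        group; so what it fixes is fixed by every automorphism and lies in \<open>K\<close> by the
        Galois property. The binary representative is found only up to \<open>I\<close>.\<close>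
      have in_K: "\<exists>v. binary_fraction v \<and> u - v \<in> I" if u: "lifts u u" for u
      proof -
        have "u \<in> LR" "\<sigma> (res u) = res u" using u by (auto simp: lifts_def)
        then have "\<forall>\<tau> \<in> carrier (gal_group L K). \<tau> (res u) = res u"
          using Z3(2)[OF \<sigma> _ _ moved] carrier_L by blast
        then have "res u \<in> K"
          using galois \<open>u \<in> LR\<close> carrier_L by (auto simp: galois_extension_def)
        then obtain v where "binary_fraction v" "res u = res v" using K by auto
        with \<open>u \<in> LR\<close> show ?thesis
          using res_eq_iff binary_fraction_in_LR by blast
      qed
      define a b c e where "a = cyc_a x y z" and "b = cyc_b x y z" and "c = cyc_c x y z"
        and "e = cyc_e x y z"
      note abce = a_def b_def c_def e_def
      have rel: "c * x * y + e * y - a * x - b = 0"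
        unfolding abce by (rule cyc_relation)
      have det: "a * e - b * c = ((x - y) * (y - z) * (z - x)) * ((x - y) * (y - z) * (z - x))"
        unfolding abce by (rule cyc_det)
      \<comment> \<open>\<open>\<sigma>\<close> carries \<open>x, y, z\<close> to
        \<open>y, z, x\<close>. The minors are written without powers and numerals, so the rules for
        sums, products and differences suffice.\<close>
      have "lifts (cyc_a x y z) (cyc_a y z x)" "lifts (cyc_b x y z) (cyc_b y z x)"
        "lifts (cyc_c x y z) (cyc_c y z x)" "lifts (cyc_e x y z) (cyc_e y z x)"
        unfolding cyc_defs by (intro lifts_add lifts_mult lifts_diff y z zx)+
      then have "lifts a a" "lifts b b" "lifts c c" "lifts e e"
        by (simp_all only: abce cyc_rotate)
      note lifts_abce = \<open>lifts a a\<close> \<open>lifts b b\<close> \<open>lifts c c\<close> \<open>lifts e e\<close>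
      obtain a' b' c' e' where bin': "binary_fraction a'" "binary_fraction b'" "binary_fraction c'"
        "binary_fraction e'" and cong: "a - a' \<in> I" "b - b' \<in> I" "c - c' \<in> I" "e - e' \<in> I"
        using in_K lifts_abce by metis
      have LR: "a \<in> LR" "b \<in> LR" "c \<in> LR" "e \<in> LR" "a' \<in> LR" "b' \<in> LR" "c' \<in> LR" "e' \<in> LR"
        using lifts_abce bin' by (auto simp: lifts_def binary_fraction_in_LR)
      \<comment> \<open>The minors satisfy the relation exactly; passing to representatives from
        \<open>K\<close> changes it by multiples of differences in \<open>I\<close>.\<close>
      have "(c - c') * x * y + (e - e') * y - (a - a') * x - (b - b') \<in> I"
        by (intro I_add I_diff I_mult(1) cong x \<open>y \<in> LR\<close>)
      also have "(c - c') * x * y + (e - e') * y - (a - a') * x - (b - b') =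
          (c * x * y + e * y - a * x - b) - (c' * x * y + e' * y - a' * x - b')"
        by (simp add: algebra_simps)
      finally have rel': "c' * slope * y + e' * y - a' * slope - b' \<in> I"
        using I_cong[of "c * x * y + e * y - a * x - b"] I_0 rel by (metis x_def)
      \<comment> \<open>A telescoping sum for the difference of the two determinants; each summand
        has a factor in \<open>I\<close>.\<close>
      have "(a - a') * e + a' * (e - e') - (b - b') * c - b' * (c - c') \<in> I"
        by (intro I_add I_diff I_mult(1)[OF cong(1)] I_mult(2)[OF _ cong(4)]
            I_mult(1)[OF cong(2)] I_mult(2)[OF _ cong(3)] LR)
      also have "(a - a') * e + a' * (e - e') - (b - b') * c - b' * (c - c') =
          (a * e - b * c) - (a' * e' - b' * c')"
        by (simp add: algebra_simps)
      finally have "a * e - b * c \<in> I \<longleftrightarrow> a' * e' - b' * c' \<in> I" by (rule I_cong)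
      \<comment> \<open>\<open>\<sigma>\<close> carries \<open>x - y\<close> to \<open>y - z\<close>
        and then to \<open>z - x\<close>, so all three differences are nonzero on the curve.\<close>
      moreover have "y - z \<notin> I" using False lifts_I_iff[OF lifts_diff[OF y z]] by simp
      moreover from this have "z - x \<notin> I" using lifts_I_iff[OF lifts_diff[OF z zx]] by simp
      ultimately have det': "a' * e' - b' * c' \<notin> I"
        using False x \<open>y \<in> LR\<close> \<open>z \<in> LR\<close>
        by (simp add: det I_mult_iff LR_closed)
      show ?thesis
        using moebius_extends[OF bin' det' y[unfolded x_def] rel'] by blast
    qed
  qed
  then have "\<forall>\<sigma> \<in> carrier (galois_group_at F P). \<exists>\<Phi>. de_jonquieres \<Phi> \<and> induces F \<Phi> \<sigma>"
    by (simp add: galois_group_at_def L_def K_def)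
  \<comment> \<open>The triple itself does not vanish on the curve, so it can serve as its own
    representative.\<close>
  moreover have "restricts_to F \<Phi> \<sigma>" if "induces F \<Phi> \<sigma>" for \<Phi> \<sigma>
  proof -
    have "\<Phi> \<noteq> 0" using that by (simp add: induces_def rational_map_def)
    then have "same_map \<Phi> \<Phi>" by (simp add: same_map_def mult.commute)
    with that show ?thesis by (auto simp: restricts_to_def)
  qed
  moreover have "cremona \<Phi>" if "de_jonquieres \<Phi>" for \<Phi>
    using that by (simp add: de_jonquieres_def)
  ultimately show ?thesis by blast
qed

end
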